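(* Let $n\geq 2$, let $K\subset\mathbb{H}^n$ be a convex body of diameter $D>0$, and let $p\in\mathrm{int}\,K$ be a fixed interior point. The following are equivalent: (i) $K$ is complete; (ii) $K=\bigcap_{x\in K}B(x,D)$; (iii) $K$ is of constant width $D$; (iv) $w_S(K,(z,H_z))=D$ for all $z\in\partial K$ and all supporting hyperplanes $H_z$ to $K$ at $z$; (v) $w_F(K,i)=D$ for all ideal points $i$; (vi) $w_L(K,(p,H_p))=D$ for all hyperplanes $H_p$ through $p$; (vii) $w(K,H)=D$ for all hyperplanes $H$ intersecting $K$.
   Context: $\mathbb{H}^n$ is $n$-dimensional hyperbolic space with geodesic distance $d$, $[x,y]$ is the geodesic segment between $x$ and $y$, $B(z,r)=\{x: d(x,z)\le r\}$. A convex body is a compact (geodesically) convex set with non-empty interior. A hyperplane $H$ supports $K$ at $z\in\partial K$ if $z\in H$ and $K$ lies in one of the closed half-spaces bounded by $H$. A set $K\subseteq\mathbb{H}^n$ is complete if $\mathrm{diam}(K\cup\{y\})>\mathrm{diam}(K)$ for each $y\in\mathbb{H}^n\setminus K$. A convex body $K$ is of constant width $D>0$ if for any $x\in\partial K$ and any outer unit normal vector $v\in T_x$ to $K$ at $x$ (i.e. exterior unit normal of a supporting hyperplane at $x$) there is $y\in\partial K$ such that $[x,y]\subset K$ has length $D$ and $-v$ points along $[x,y]$ (is the initial direction of the segment at $x$). Santaló width: for $z\in\partial K$ and a supporting hyperplane $H_z$ at $z$, let $\ell$ be the line through $z$ orthogonal to $H_z$, let $H'_z$ be the unique supporting hyperplane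 of $K$ orthogonal to $\ell$ and disjoint from $H_z$, and $\{z'\}=H'_z\cap\ell$; then $w_S(K,(z,H_z))=d(z,z')$. Fillmore width: a horosphere $\partial A$ (boundary of a horoball $A$) supports $K$ if $\partial A\cap\partial K\ne\emptyset$ and either $K\subset A$ or $K\subset\mathbb{H}^n\setminus\mathrm{int}\,A$. For each ideal point $i$ there are exactly two supporting horospheres of $K$ centred at $i$; $w_F(K,i)$ is the distance between them, i.e. the length of the segment they cut out of any line having $i$ as an ideal point. Hyperspherical width: for a hyperplane $H$ let $H^{(\varepsilon)}=\{x:d(x,H)\le\varepsilon\}$. For a hyperplane $H$ with $H\cap K\neq\emptyset$, bounding closed half-spaces $H^+,H^-$, the supporting hyperspherical domain is the closed set $\mathcal{A}\supset K$ bounded by the component of $\partial H^{(\varepsilon)}$ in $H^+$ and the component of $\partial H^{(\varepsilon')}$ in $H^-$, both of which meet $K$ (if $H$ supports $K$, one of them is $H$ itself, with distance $0$). Put $w_{hyp}(K,H)=\varepsilon+\varepsilon'$; equivalently $w_{hyp}(K,H)=\max_{x\in K\cap H^+}d(x,H)+\max_{x\in K\cap H^-}d(x,H)$. Leichtweiss width: $w_L(K,(p,H_p))=w_{hyp}(K,H_p)$ for $p\in\mathrm{int}\,K$ and a hyperplane $H_p\ni p$. Extended Leichtweiss width: $w(K,H)=w_{hyp}(K,H)$ for any hyperplane $H$ intersecting $K$. *)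

theory Defs
  imports "HOL-Analysis.Analysis"
begin

(* Hyperbolic n-space, n = DIM('a), as the upper sheet of the hyperboloid <P,P> = -1
   in the Lorentz space 'a \<times> real, whose last coordinate is the time coordinate. *)

definition mink :: "'a::euclidean_space \<times> real \<Rightarrow> 'a \<times> real \<Rightarrow> real"
  where "mink P Q = fst P \<bullet> fst Q - snd P * snd Q"

typedef (overloaded) ('a::euclidean_space) hyp =
  "{P :: 'a \<times> real. mink P P = -1 \<and> snd P > 0}"
  morphisms coords Abs_hyp
  by (rule exI[of _ "(0, 1)"]) (simp add: mink_def)

lemma mink_commute: "mink P Q = mink Q P"
  by (simp add: mink_def inner_commute)

lemma mink_linear:
  "mink (P + Q) R = mink P R + mink Q R" "mink R (P + Q) = mink R P + mink R Q"
  "mink (P - Q) R = mink P R - mink Q R" "mink R (P - Q) = mink R P - mink R Q"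
  "mink (c *\<^sub>R P) R = c * mink P R" "mink R (c *\<^sub>R P) = c * mink R P"
  "mink (- P) R = - mink P R" "mink R (- P) = - mink R P"
  by (simp_all add: mink_def algebra_simps)

lemma mink_coords_self [simp]: "mink (coords p) (coords p) = -1"
  and snd_coords_pos: "snd (coords p) > 0"
  using coords[of p] by auto

lemma mink_coords_le: "mink (coords p) (coords q) \<le> -1"
proof -
  obtain a s where p: "coords p = (a, s)" by (cases "coords p")
  obtain b t where q: "coords q = (b, t)" by (cases "coords q")
  have s: "s > 0" "a \<bullet> a = s\<^sup>2 - 1" and t: "t > 0" "b \<bullet> b = t\<^sup>2 - 1"
    using coords[of p] coords[of q] by (auto simp: p q mink_def power2_eq_square)
  have "s\<^sup>2 \<ge> 1" "t\<^sup>2 \<ge> 1"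
    using s t inner_ge_zero[of a] inner_ge_zero[of b] by linarith+
  hence "s \<ge> 1" "t \<ge> 1"
    using s(1) t(1) by (auto intro: power2_le_imp_le)
  hence "s * t \<ge> 1"
    by (metis mult_mono mult_1 zero_le_one order_trans)
  have "(a \<bullet> b)\<^sup>2 \<le> (s\<^sup>2 - 1) * (t\<^sup>2 - 1)"
    using Cauchy_Schwarz_ineq[of a b] by (simp only: s(2) t(2))
  also have "\<dots> = (s * t - 1)\<^sup>2 - (s - t)\<^sup>2"
    by (simp add: power2_eq_square algebra_simps)
  also have "\<dots> \<le> (s * t - 1)\<^sup>2"
    by simp
  finally have "a \<bullet> b \<le> s * t - 1"
    using \<open>s * t \<ge> 1\<close> by (rule power2_le_imp_le[OF _ diff_ge_0_iff_ge[THEN iffD2]])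
  thus ?thesis
    by (simp add: p q mink_def)
qed

lemma mink_orthogonal_nonneg:
  assumes "mink (coords p) V = 0"
  shows "mink V V \<ge> 0" and "mink V V = 0 \<Longrightarrow> V = 0"
    and "(snd V)\<^sup>2 \<le> mink V V * ((snd (coords p))\<^sup>2 - 1)"
proof -
  obtain a t where p: "coords p = (a, t)" by (cases "coords p")
  obtain v s where V: "V = (v, s)" by (cases V)
  have t: "t > 0" "a \<bullet> a = t\<^sup>2 - 1"
    using coords[of p] by (auto simp: p mink_def power2_eq_square)
  have "(a \<bullet> v)\<^sup>2 \<le> (a \<bullet> a) * (v \<bullet> v)"
    by (rule Cauchy_Schwarz_ineq)
  hence le: "t\<^sup>2 * s\<^sup>2 \<le> (t\<^sup>2 - 1) * (v \<bullet> v)"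
    using assms t by (simp add: p V mink_def power_mult_distrib)
  have "t\<^sup>2 * (v \<bullet> v - s\<^sup>2) \<ge> v \<bullet> v"
    using le by (simp add: algebra_simps)
  hence *: "v \<bullet> v \<le> t\<^sup>2 * mink V V"
    by (simp add: V mink_def power2_eq_square)
  have "0 \<le> t\<^sup>2 * mink V V"
    using * inner_ge_zero[of v] by linarith
  thus nonneg: "mink V V \<ge> 0"
    using t by (simp add: zero_le_mult_iff)
  show "V = 0" if "mink V V = 0"
  proof -
    have "v = 0"
      using * that inner_ge_zero[of v] by simp
    thus ?thesis
      using that by (simp add: V mink_def zero_prod_def)
  qed
  have "s\<^sup>2 \<le> mink V V * (t\<^sup>2 - 1)"
    using le by (simp add: V mink_def power2_eq_square algebra_simps)
  thus "(snd V)\<^sup>2 \<le> mink V V * ((snd (coords p))\<^sup>2 - 1)"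
    by (simp add: V p)
qed

lemma mink_Cauchy_Schwarz:
  assumes "mink (coords p) X = 0" "mink (coords p) Z = 0"
  shows "(mink X Z)\<^sup>2 \<le> mink X X * mink Z Z"
proof (cases "mink Z Z = 0")
  case True
  hence "Z = 0"
    using mink_orthogonal_nonneg(2)[OF assms(2)] by simp
  thus ?thesis
    by (simp add: mink_def)
next
  case False
  define W where "W = mink Z Z *\<^sub>R X - mink X Z *\<^sub>R Z"
  have "mink (coords p) W = 0"
    using assms by (simp add: W_def mink_linear)
  hence "0 \<le> mink W W"
    by (rule mink_orthogonal_nonneg)
  also have "mink W W = mink Z Z * (mink X X * mink Z Z - (mink X Z)\<^sup>2)"
    by (simp add: W_def mink_linear mink_commute[of Z X]
        power2_eq_square algebra_simps)
  finally show ?thesis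
    using False mink_orthogonal_nonneg(1)[OF assms(2)] by (simp add: zero_le_mult_iff)
qed

instantiation hyp :: (euclidean_space) metric_space
begin

definition dist_hyp :: "'a hyp \<Rightarrow> 'a hyp \<Rightarrow> real"
  where "dist_hyp p q = arcosh (- mink (coords p) (coords q))"

definition uniformity_hyp :: "('a hyp \<times> 'a hyp) filter"
  where "uniformity_hyp = (INF e\<in>{0 <..}. principal {(x, y). dist x y < e})"

definition open_hyp :: "'a hyp set \<Rightarrow> bool"
  where "open_hyp U = (\<forall>x\<in>U. \<forall>\<^sub>F (x', y) in uniformity. x' = x \<longrightarrow> y \<in> U)"

instance
proof
  fix x y z :: "'a hyp"
  show "(dist x y = 0) = (x = y)"
  proof
    assume "dist x y = 0"
    hence m: "mink (coords x) (coords y) = -1"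
      using mink_coords_le[of x y] by (simp add: dist_hyp_def)
    define V where "V = coords x - coords y"
    have "mink (coords x) V = 0" "mink V V = 0"
      using m by (simp_all add: V_def mink_linear mink_commute[of "coords y" "coords x"])
    hence "V = 0"
      using mink_orthogonal_nonneg(2) by blast
    thus "x = y"
      by (simp add: V_def coords_inject)
  qed (simp add: dist_hyp_def)
  show "dist x y \<le> dist x z + dist y z"
  proof -
    define X where "X = coords x + mink (coords z) (coords x) *\<^sub>R coords z"
    define Y where "Y = coords y + mink (coords z) (coords y) *\<^sub>R coords z"
    define a where "a = - mink (coords x) (coords z)"
    define b where "b = - mink (coords y) (coords z)"
    have ab: "a \<ge> 1" "b \<ge> 1"
      using mink_coords_le[of x z] mink_coords_le[of y z] by (simp_all add: a_def b_def)
    have "mink (coords z) X = 0" "mink (coords z) Y = 0"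
      by (simp_all add: X_def Y_def mink_linear)
    hence "(mink X Y)\<^sup>2 \<le> mink X X * mink Y Y"
      by (rule mink_Cauchy_Schwarz)
    also have "mink X X = a\<^sup>2 - 1"
      by (simp add: X_def a_def mink_linear mink_commute[of "coords z" "coords x"]
          mink_commute[of "coords z" "coords y"] power2_eq_square)
    also have "mink Y Y = b\<^sup>2 - 1"
      by (simp add: Y_def b_def mink_linear mink_commute[of "coords z" "coords x"]
          mink_commute[of "coords z" "coords y"] power2_eq_square)
    also have "mink X Y = mink (coords x) (coords y) + a * b"
      by (simp add: X_def Y_def a_def b_def mink_linear mink_commute[of "coords z" "coords x"]
          mink_commute[of "coords z" "coords y"])
    finally have "sqrt ((mink (coords x) (coords y) + a * b)\<^sup>2) \<le> sqrt ((a\<^sup>2 - 1) * (b\<^sup>2 - 1))"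
      by (rule real_sqrt_le_mono)
    hence "- mink (coords x) (coords y) \<le> a * b + sqrt (a\<^sup>2 - 1) * sqrt (b\<^sup>2 - 1)"
      by (simp add: real_sqrt_mult)
    also have "\<dots> = cosh (arcosh a + arcosh b)"
      using ab by (simp add: cosh_add sinh_arcosh_real)
    finally have "cosh (dist x y) \<le> cosh (arcosh a + arcosh b)"
      using mink_coords_le[of x y] by (simp add: dist_hyp_def)
    hence "dist x y \<le> arcosh a + arcosh b"
      using ab mink_coords_le[of x y] by (subst (asm) cosh_real_nonneg_le_iff) (auto simp: dist_hyp_def)
    thus ?thesis
      by (simp add: dist_hyp_def a_def b_def)
  qed
qed (rule uniformity_hyp_def open_hyp_def)+

end

(* The tangent space at p is the Lorentz orthogonal complement of p. *)

definition unit_tangent :: "'a::euclidean_space hyp \<Rightarrow> 'a \<times> real \<Rightarrow> bool"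
  where "unit_tangent p u \<longleftrightarrow> mink (coords p) u = 0 \<and> mink u u = 1"

(* The unit speed geodesic with initial point p and initial direction u. *)

definition hgeo :: "'a::euclidean_space hyp \<Rightarrow> 'a \<times> real \<Rightarrow> real \<Rightarrow> 'a hyp"
  where "hgeo p u t = Abs_hyp (cosh t *\<^sub>R coords p + sinh t *\<^sub>R u)"

lemma coords_hgeo:
  assumes "unit_tangent p u"
  shows "coords (hgeo p u t) = cosh t *\<^sub>R coords p + sinh t *\<^sub>R u"
proof -
  let ?Q = "cosh t *\<^sub>R coords p + sinh t *\<^sub>R u"
  have u: "mink (coords p) u = 0" "mink u (coords p) = 0" "mink u u = 1"
    using assms by (simp_all add: unit_tangent_def mink_commute[of u "coords p"])
  have "(snd u)\<^sup>2 \<le> (snd (coords p))\<^sup>2 - 1"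
    using mink_orthogonal_nonneg(3)[OF u(1)] by (simp only: u(3) mult_1_left)
  hence "\<bar>snd u\<bar>\<^sup>2 < (snd (coords p))\<^sup>2"
    unfolding power2_abs by (rule le_less_trans) simp
  hence lt: "\<bar>snd u\<bar> < snd (coords p)"
    using less_imp_le[OF snd_coords_pos] by (rule power2_less_imp_less)
  have "\<bar>sinh t\<bar> \<le> cosh t"
    using abs_le_square_iff[of "sinh t" "cosh t"] by (simp add: cosh_square_eq)
  hence "\<bar>sinh t\<bar> * \<bar>snd u\<bar> \<le> cosh t * \<bar>snd u\<bar>"
    by (intro mult_right_mono) auto
  also have "\<dots> < cosh t * snd (coords p)"
    using lt cosh_real_pos by (rule mult_strict_left_mono)
  finally have "\<bar>sinh t * snd u\<bar> < cosh t * snd (coords p)"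
    by (simp only: abs_mult)
  hence "snd ?Q > 0"
    unfolding snd_add snd_scaleR real_scaleR_def abs_less_iff by linarith
  moreover have "mink ?Q ?Q = -1"
    using cosh_square_eq[of t] by (simp add: mink_linear u power2_eq_square)
  ultimately show ?thesis
    by (simp add: hgeo_def Abs_hyp_inverse)
qed

lemma dist_hgeo:
  assumes "unit_tangent p u"
  shows "dist (hgeo p u s) (hgeo p u t) = \<bar>t - s\<bar>"
proof -
  have u: "mink (coords p) u = 0" "mink u (coords p) = 0" "mink u u = 1"
    using assms by (simp_all add: unit_tangent_def mink_commute[of u "coords p"])
  have "- mink (coords (hgeo p u s)) (coords (hgeo p u t)) = cosh (t - s)"
    by (simp add: coords_hgeo[OF assms] mink_linear u cosh_diff)
  also have "\<dots> = cosh \<bar>t - s\<bar>"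
    by (rule cosh_real_abs[symmetric])
  finally show ?thesis
    by (simp only: dist_hyp_def arcosh_cosh_real abs_ge_zero)
qed

definition hsegment :: "'a::euclidean_space hyp \<Rightarrow> 'a hyp \<Rightarrow> 'a hyp set"
  where "hsegment x y =
    {z. \<exists>u s t. unit_tangent x u \<and> 0 \<le> s \<and> s \<le> t \<and> y = hgeo x u t \<and> z = hgeo x u s}"

definition hline :: "'a::euclidean_space hyp set \<Rightarrow> bool"
  where "hline l \<longleftrightarrow> (\<exists>p u. unit_tangent p u \<and> l = range (hgeo p u))"

definition hconvex :: "'a::euclidean_space hyp set \<Rightarrow> bool"
  where "hconvex K \<longleftrightarrow> (\<forall>x\<in>K. \<forall>y\<in>K. hsegment x y \<subseteq> K)"

definition convex_body :: "'a::euclidean_space hyp set \<Rightarrow> bool"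
  where "convex_body K \<longleftrightarrow> compact K \<and> hconvex K \<and> interior K \<noteq> {}"

(* For mink v v = 1, hyperplane v is a hyperplane and halfspace v, halfspace (- v) are the closed
   half-spaces bounded by it.  At each of its points, v itself is tangent to hyperbolic space, is
   a unit normal of the hyperplane and points out of halfspace v. *)

definition hyperplane :: "'a::euclidean_space \<times> real \<Rightarrow> 'a hyp set"
  where "hyperplane v = {x. mink (coords x) v = 0}"

definition halfspace :: "'a::euclidean_space \<times> real \<Rightarrow> 'a hyp set"
  where "halfspace v = {x. mink (coords x) v \<le> 0}"

definition is_hyperplane :: "'a::euclidean_space hyp set \<Rightarrow> bool"
  where "is_hyperplane H \<longleftrightarrow> (\<exists>v. mink v v = 1 \<and> H = hyperplane v)"

(* As hyperplane v = hyperplane (- v), either closed half-space of H may contain K. *)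

definition supports_at :: "'a::euclidean_space hyp set \<Rightarrow> 'a hyp \<Rightarrow> 'a hyp set \<Rightarrow> bool"
  where "supports_at K z H \<longleftrightarrow> z \<in> frontier K \<and> z \<in> H \<and>
    (\<exists>v. mink v v = 1 \<and> H = hyperplane v \<and> K \<subseteq> halfspace v)"

definition outer_unit_normal :: "'a::euclidean_space hyp set \<Rightarrow> 'a hyp \<Rightarrow> 'a \<times> real \<Rightarrow> bool"
  where "outer_unit_normal K x v \<longleftrightarrow>
    unit_tangent x v \<and> supports_at K x (hyperplane v) \<and> K \<subseteq> halfspace v"

definition orthogonal_to_hyperplane :: "'a::euclidean_space hyp set \<Rightarrow> 'a hyp set \<Rightarrow> bool"
  where "orthogonal_to_hyperplane l H \<longleftrightarrow>
    (\<exists>p v. mink v v = 1 \<and> H = hyperplane v \<and> p \<in> H \<and> l = range (hgeo p v))"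

(* Completeness in the sense of diameters; unrelated to the library's Cauchy completeness. *)

definition diam_complete :: "'a::metric_space set \<Rightarrow> bool"
  where "diam_complete K \<longleftrightarrow> (\<forall>y. y \<notin> K \<longrightarrow> diameter (insert y K) > diameter K)"

definition constant_width :: "'a::euclidean_space hyp set \<Rightarrow> real \<Rightarrow> bool"
  where "constant_width K D \<longleftrightarrow> (\<forall>x\<in>frontier K. \<forall>v. outer_unit_normal K x v \<longrightarrow>
    (\<exists>y\<in>frontier K. hsegment x y \<subseteq> K \<and> dist x y = D \<and> y = hgeo x (- v) D))"

definition santalo_width :: "'a::euclidean_space hyp set \<Rightarrow> 'a hyp \<Rightarrow> 'a hyp set \<Rightarrow> real"
  where "santalo_width K z H = dist z (THE z'. \<exists>l H'.
    z \<in> l \<and> orthogonal_to_hyperplane l H \<and>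
    (\<exists>q. supports_at K q H') \<and> orthogonal_to_hyperplane l H' \<and> H' \<inter> H = {} \<and>
    H' \<inter> l = {z'})"

(* An ideal point is represented by a unit vector i of 'a, i.e. by the null direction (i, 1); this
   is the boundary point i of the unit ball in the Klein model x |-> fst x / snd x. *)

definition has_ideal_point :: "'a::euclidean_space hyp set \<Rightarrow> 'a \<Rightarrow> bool"
  where "has_ideal_point l i \<longleftrightarrow> (\<exists>p u. unit_tangent p u \<and> l = range (hgeo p u) \<and>
    ((\<lambda>t. fst (coords (hgeo p u t)) /\<^sub>R snd (coords (hgeo p u t))) \<longlongrightarrow> i) at_top)"

(* For c > 0 these are the horoballs centred at i: ln (- mink (coords x) (i, 1)) is the Busemann
   function of i. *)

definition horoball :: "'a::euclidean_space \<Rightarrow> real \<Rightarrow> 'a hyp set"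
  where "horoball i c = {x. - mink (coords x) (i, 1) \<le> c}"

definition supporting_horosphere :: "'a::euclidean_space hyp set \<Rightarrow> 'a \<Rightarrow> 'a hyp set \<Rightarrow> bool"
  where "supporting_horosphere K i S \<longleftrightarrow> (\<exists>c>0. S = frontier (horoball i c) \<and>
    S \<inter> frontier K \<noteq> {} \<and> (K \<subseteq> horoball i c \<or> K \<subseteq> - interior (horoball i c)))"

definition fillmore_width :: "'a::euclidean_space hyp set \<Rightarrow> 'a \<Rightarrow> real"
  where "fillmore_width K i = (THE w. \<exists>S S'. S \<noteq> S' \<and>
    supporting_horosphere K i S \<and> supporting_horosphere K i S' \<and>
    (\<forall>l. hline l \<and> has_ideal_point l i \<longrightarrow>
      (\<exists>x x'. l \<inter> S = {x} \<and> l \<inter> S' = {x'} \<and> dist x x' = w)))"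

definition hyperplane_nbhd :: "'a::euclidean_space hyp set \<Rightarrow> real \<Rightarrow> 'a hyp set"
  where "hyperplane_nbhd H e = {x. infdist x H \<le> e}"

(* The half-space of H on side v is halfspace (- v), where mink (coords x) v \<ge> 0.  For e = 0 the
   set frontier (hyperplane_nbhd H e) is H, hence so is its part in either half-space. *)

definition supporting_hyperspherical ::
    "'a::euclidean_space hyp set \<Rightarrow> 'a \<times> real \<Rightarrow> real \<Rightarrow> real \<Rightarrow> bool"
  where "supporting_hyperspherical K v e e' \<longleftrightarrow> e \<ge> 0 \<and> e' \<ge> 0 \<and>
    K \<subseteq> (hyperplane_nbhd (hyperplane v) e \<inter> halfspace (- v)) \<union>
        (hyperplane_nbhd (hyperplane v) e' \<inter> halfspace v) \<and>
    K \<inter> frontier (hyperplane_nbhd (hyperplane v) e) \<inter> halfspace (- v) \<noteq> {} \<and>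
    K \<inter> frontier (hyperplane_nbhd (hyperplane v) e') \<inter> halfspace v \<noteq> {}"

(* Replacing v by - v exchanges e and e', so the width depends on H only. *)

definition hyp_width :: "'a::euclidean_space hyp set \<Rightarrow> 'a hyp set \<Rightarrow> real"
  where "hyp_width K H = (THE w. \<exists>v e e'. mink v v = 1 \<and> H = hyperplane v \<and>
    supporting_hyperspherical K v e e' \<and> w = e + e')"

(* Used only for p in the interior of K and H a hyperplane through p. *)

definition leichtweiss_width :: "'a::euclidean_space hyp set \<Rightarrow> 'a hyp \<Rightarrow> 'a hyp set \<Rightarrow> real"
  where "leichtweiss_width K p H = hyp_width K H"

definition extended_leichtweiss_width :: "'a::euclidean_space hyp set \<Rightarrow> 'a hyp set \<Rightarrow> real"
  where "extended_leichtweiss_width K H = hyp_width K H"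

end

theory Submission
  imports Defs
begin

text \<open>
  Most properties are compared with one that concerns single normals, \<open>opposite_points K D\<close>: from
  a boundary point, walking the distance \<open>D\<close> along an inner normal leads to a point of \<open>K\<close>.  As
  \<open>D\<close> is the diameter, this is a restatement of constant width.

  \<^item> Completeness implies it (\<open>complete_imp_opposite_points\<close>): if the point \<open>z\<close> opposite to \<open>x\<close>
    were at distance more than \<open>D\<close> from some \<open>q \<in> K\<close>, there would be a direction at \<open>x\<close> that
    leads out of \<open>K\<close> and forms an acute angle with the direction of every diameter that ends at
    \<open>x\<close>.  By compactness, points slightly outside of \<open>K\<close> in this direction could be added to \<open>K\<close>
    without increasing the diameter.  Conversely, for \<open>y \<notin> K\<close> with nearest point \<open>x \<in> K\<close>, the
    point opposite to \<open>x\<close> is farther than \<open>D\<close> from \<open>y\<close>.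

  \<^item> If \<open>x\<close> is a point of \<open>K\<close> with an extreme value of a function that is 1-Lipschitz and has unit
    gradient, such as the signed distance from a hyperplane or a Busemann function, and if moreover
    the gradient at \<open>x\<close>, up to sign, is an outer normal of \<open>K\<close>, then the value at the opposite point
    differs by exactly \<open>D\<close>; so the width is \<open>D\<close>.  This applies to the horospherical and the
    hyperspherical widths.  For the width between hyperplanes, the ball of radius \<open>D\<close> about \<open>x\<close>
    contains \<open>K\<close> and is supported at the opposite point by the second hyperplane.

  \<^item> In the other direction, let the width between supporting hyperplanes or horospheres be \<open>D\<close>, and
    let \<open>x\<close> be a boundary point with a normal.  The function to be used is the signed distance from
    the hyperplane opposite to the one at \<open>x\<close>, or the Busemann function of the ideal point to which
    the outer normal points.  Its value at some point of \<open>K\<close> differs by \<open>D\<close> from that at \<open>x\<close>, and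
    this must be the opposite point, since equality in the Lipschitz bound holds only along the
    lines perpendicular to the level sets (\<open>signed_dist\<close>, \<open>busemann_dist\<close>).

  \<^item> This does not work for the hyperplanes through a fixed point \<open>p\<close>: the equidistant
    hypersurfaces that are tangent to a supporting hyperplane are curved to the wrong side.
    Instead, hyperbolic space is projected to a Euclidean space along \<open>p\<close> (\<open>gans\<close>).  The
    equidistant hypersurfaces of hyperplanes through \<open>p\<close> become Euclidean hyperplanes, and since
    the extreme points of \<open>K\<close> are unique, the image of \<open>K\<close> is convex (\<open>gans_image_convex\<close>).
    So a point outside of \<open>K\<close> lies beyond the maximum of some signed distance, which makes
    its distance from the corresponding minimum point greater than \<open>D\<close>
    (\<open>hyp_width_imp_complete\<close>).
\<close>

section \<open>Tangent vectors and geodesics\<close>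

lemma cosh_dist: "cosh (dist x y) = - mink (coords x) (coords y)"
  using mink_coords_le[of x y] by (simp add: dist_hyp_def)

lemma dist_le_iff:
  assumes "0 \<le> D"
  shows "dist x y \<le> D \<longleftrightarrow> - mink (coords x) (coords y) \<le> cosh D"
  using cosh_real_nonneg_le_iff[of "dist x y" D] assms by (simp add: cosh_dist)

lemma unit_tangentD:
  assumes "unit_tangent p u"
  shows "mink (coords p) u = 0" "mink u (coords p) = 0" "mink u u = 1"
  using assms by (simp_all add: unit_tangent_def mink_commute[of u "coords p"])

lemma unit_tangent_minus [simp]: "unit_tangent p (- u) \<longleftrightarrow> unit_tangent p u"
  by (simp add: unit_tangent_def mink_linear)

lemma hgeo_minus: "hgeo p (- u) t = hgeo p u (- t)"
  by (simp add: hgeo_def)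

lemma hgeo_0 [simp]: "hgeo p u 0 = p"
  by (simp add: hgeo_def coords_inverse)

lemma mink_hgeo:
  assumes "unit_tangent p u"
  shows "mink (coords (hgeo p u t)) X = cosh t * mink (coords p) X + sinh t * mink u X"
  by (simp add: coords_hgeo[OF assms] mink_linear)

lemma dist_hgeo_0:
  assumes "unit_tangent p u"
  shows "dist p (hgeo p u t) = \<bar>t\<bar>"
  using dist_hgeo[OF assms, of 0 t] by simp

lemma unit_tangent_normalize:
  assumes "mink (coords x) V = 0" "V \<noteq> 0"
  shows "mink V V > 0" "unit_tangent x (V /\<^sub>R sqrt (mink V V))"
proof -
  show pos: "mink V V > 0"
    using mink_orthogonal_nonneg[OF assms(1)] assms(2) by force
  show "unit_tangent x (V /\<^sub>R sqrt (mink V V))"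
    using pos assms(1) by (simp add: unit_tangent_def mink_linear field_simps)
qed

text \<open>Also the constant geodesic from a point to itself needs some initial direction.\<close>

lemma unit_tangent_exists: "\<exists>u. unit_tangent (x::'a::euclidean_space hyp) u"
proof -
  obtain b :: 'a where b: "b \<in> Basis"
    using nonempty_Basis by blast
  define e :: "'a \<times> real" where "e = (b, 0)"
  define V where "V = e + mink (coords x) e *\<^sub>R coords x"
  have e: "mink e e = 1"
    using b by (simp add: e_def mink_def)
  have "mink (coords x) V = 0"
    by (simp add: V_def mink_linear)
  moreover have "mink V V = 1 + (mink (coords x) e)\<^sup>2"
    by (simp add: V_def mink_linear e mink_commute[of e "coords x"] power2_eq_square)
  hence "mink V V > 0"
    by (simp add: add_pos_nonneg)
  hence "V \<noteq> 0"
    by (auto simp: mink_def)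
  ultimately show ?thesis
    using unit_tangent_normalize(2) by blast
qed

lemma geodesic_between:
  obtains u where "unit_tangent x u" "y = hgeo x u (dist x y)"
proof (cases "x = y")
  case True
  with unit_tangent_exists[of x] that show ?thesis by auto
next
  case False
  define t where "t = dist x y"
  define u where "u = (coords y - cosh t *\<^sub>R coords x) /\<^sub>R sinh t"
  have t: "t > 0"
    using False by (simp add: t_def)
  have m: "mink (coords x) (coords y) = - cosh t" "mink (coords y) (coords x) = - cosh t"
    by (simp_all add: t_def cosh_dist mink_commute[of "coords y"])
  have "mink (coords x) u = 0"
    by (simp add: u_def mink_linear m)
  moreover have "mink u u = (cosh t ^ 2 - 1) / (sinh t) ^ 2"
    using t by (simp add: u_def mink_linear m power2_eq_square field_simps)
  hence "mink u u = 1"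
    using t by (simp add: cosh_square_eq)
  ultimately have u: "unit_tangent x u"
    by (simp add: unit_tangent_def)
  have "coords (hgeo x u t) = coords y"
    using t by (simp add: coords_hgeo[OF u]) (simp add: u_def)
  with u show ?thesis
    by (intro that[of u]) (simp_all add: t_def coords_inject)
qed

lemma unit_tangent_mink:
  assumes "unit_tangent x u" "unit_tangent x n"
  shows "\<bar>mink u n\<bar> \<le> 1" "mink u n = 1 \<Longrightarrow> u = n" "mink u n = - 1 \<Longrightarrow> u = - n"
proof -
  note D = unit_tangentD[OF assms(1)] unit_tangentD[OF assms(2)]
  have "(mink u n)\<^sup>2 \<le> 1"
    using mink_Cauchy_Schwarz[OF D(1) D(4)] by (simp add: D)
  thus "\<bar>mink u n\<bar> \<le> 1"
    by (simp add: abs_square_le_1)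
  show "u = n" if "mink u n = 1"
    using mink_orthogonal_nonneg(2)[of x "u - n"] D that
    by (simp add: mink_linear mink_commute[of n u])
  show "u = - n" if "mink u n = - 1"
    using mink_orthogonal_nonneg(2)[of x "u + n"] D that
    by (simp add: mink_linear mink_commute[of n u] eq_neg_iff_add_eq_0)
qed

lemma snd_unit_tangent_less:
  assumes "unit_tangent p u"
  shows "\<bar>snd u\<bar> < snd (coords p)"
proof -
  note u = unit_tangentD[OF assms]
  have "(snd u)\<^sup>2 \<le> (snd (coords p))\<^sup>2 - 1"
    using mink_orthogonal_nonneg(3)[OF u(1)] by (simp only: u(3) mult_1_left)
  hence "\<bar>snd u\<bar>\<^sup>2 < (snd (coords p))\<^sup>2"
    unfolding power2_abs by (rule le_less_trans) simp
  thus ?thesis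
    using less_imp_le[OF snd_coords_pos] by (rule power2_less_imp_less)
qed

lemma continuous_coords: "continuous_on UNIV (coords :: 'a::euclidean_space hyp \<Rightarrow> _)"
  unfolding continuous_on_def
proof (intro ballI)
  fix x :: "'a hyp"
  let ?d = "\<lambda>y. dist x y"
  have bound: "norm (coords y - coords x)
    \<le> (cosh (?d y) - 1) * norm (coords x) + sinh (?d y) * (2 * snd (coords x))" for y
  proof -
    obtain u where u: "unit_tangent x u" "y = hgeo x u (?d y)"
      by (rule geodesic_between)
    have y: "coords y - coords x = (cosh (?d y) - 1) *\<^sub>R coords x + sinh (?d y) *\<^sub>R u"
      by (subst (1) u(2)) (simp add: coords_hgeo[OF u(1)] algebra_simps)
    have "(snd u)\<^sup>2 \<le> (snd (coords x))\<^sup>2 - 1"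
      using mink_orthogonal_nonneg(3)[of x u] unit_tangentD[OF u(1)] by simp
    hence "(norm (fst u))\<^sup>2 \<le> (snd (coords x))\<^sup>2"
      using unit_tangentD(3)[OF u(1)]
      by (simp add: mink_def power2_eq_square flip: power2_norm_eq_inner)
    hence "norm (fst u) \<le> snd (coords x)"
      by (rule power2_le_imp_le) (use snd_coords_pos[of x] in simp)
    moreover have "norm u \<le> norm (fst u) + norm (snd u)"
      using norm_Pair_le[of "fst u" "snd u"] by simp
    ultimately have "norm u \<le> 2 * snd (coords x)"
      using snd_unit_tangent_less[OF u(1)] by simp
    hence "sinh (?d y) * norm u \<le> sinh (?d y) * (2 * snd (coords x))"
      by (intro mult_left_mono) auto
    moreover have "norm (coords y - coords x) \<le> norm ((cosh (?d y) - 1) *\<^sub>R coords x) + norm (sinh (?d y) *\<^sub>R u)"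
      unfolding y by (rule norm_triangle_ineq)
    ultimately show ?thesis
      using cosh_real_ge_1[of "?d y"] by simp
  qed
  have "((\<lambda>y. (cosh (?d y) - 1) * norm (coords x) + sinh (?d y) * (2 * snd (coords x)))
      \<longlongrightarrow> (cosh (?d x) - 1) * norm (coords x) + sinh (?d x) * (2 * snd (coords x))) (at x)"
    by (intro tendsto_intros)
  hence "((\<lambda>y. (cosh (?d y) - 1) * norm (coords x) + sinh (?d y) * (2 * snd (coords x))) \<longlongrightarrow> 0) (at x)"
    by simp
  hence "((\<lambda>y. coords y - coords x) \<longlongrightarrow> 0) (at x)"
    by (rule Lim_null_comparison[rotated]) (use bound in simp)
  thus "(coords \<longlongrightarrow> coords x) (at x)"
    by (simp add: LIM_zero_iff)
qed

lemma continuous_mink_coords: "continuous_on A (\<lambda>x. mink (coords x) v)"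
  unfolding mink_def
  by (intro continuous_intros continuous_on_subset[OF continuous_coords]) auto

lemma hgeo_mem_hsegment:
  assumes "unit_tangent x u" "0 \<le> s" "s \<le> t"
  shows "hgeo x u s \<in> hsegment x (hgeo x u t)"
  unfolding hsegment_def using assms by blast

text \<open>The geodesic segment contains all points of the cone spanned by its end points.\<close>

lemma mem_hsegmentI:
  assumes "coords z = a *\<^sub>R coords x + b *\<^sub>R coords y" "a \<ge> 0" "b \<ge> 0"
  shows "z \<in> hsegment x y"
proof -
  define t where "t = dist x y"
  obtain u where u: "unit_tangent x u" "y = hgeo x u t"
    unfolding t_def by (rule geodesic_between)
  have t: "t \<ge> 0"
    by (simp add: t_def)
  define s where "s = arsinh (b * sinh t)"
  have z: "coords z = (a + b * cosh t) *\<^sub>R coords x + (b * sinh t) *\<^sub>R u"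
    unfolding assms(1) by (subst u(2)) (simp add: coords_hgeo[OF u(1)] algebra_simps)
  have "mink (coords z) (coords z) = (b * sinh t)\<^sup>2 - (a + b * cosh t)\<^sup>2"
    unfolding z by (simp add: mink_linear unit_tangentD[OF u(1)] power2_eq_square algebra_simps)
  hence "(a + b * cosh t)\<^sup>2 = cosh s ^ 2"
    by (simp add: cosh_square_eq s_def)
  moreover have "a + b * cosh t \<ge> 0"
    using assms by simp
  ultimately have c: "a + b * cosh t = cosh s"
    by (simp add: power2_eq_iff_nonneg)
  have "sinh (t - s) = a * sinh t"
    unfolding sinh_diff c[symmetric] by (simp add: s_def algebra_simps)
  hence "sinh (t - s) \<ge> 0"
    using assms t by simp
  hence "s \<le> t"
    by simp
  moreover have "sinh s \<ge> 0"
    using assms t by (simp add: s_def)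
  hence "s \<ge> 0"
    by simp
  moreover have "coords z = coords (hgeo x u s)"
    unfolding z c by (simp add: coords_hgeo[OF u(1)] s_def)
  ultimately show ?thesis
    using hgeo_mem_hsegment[OF u(1)] by (simp add: u(2) coords_inject)
qed

section \<open>Distances from a hyperplane\<close>

text \<open>If \<open>a\<close> is the signed distance of \<open>x\<close> from the hyperplane with normal \<open>v\<close>, that is,
  \<open>mink (coords x) v = sinh a\<close>, then this is the gradient at \<open>x\<close> of the signed distance: the unit
  normal of the equidistant hypersurface through \<open>x\<close>.\<close>

definition hyp_normal :: "'a::euclidean_space \<times> real \<Rightarrow> 'a hyp \<Rightarrow> real \<Rightarrow> 'a \<times> real"
  where "hyp_normal v x a = (v + sinh a *\<^sub>R coords x) /\<^sub>R cosh a"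

lemma hyp_normal:
  assumes "mink v v = 1" "mink (coords x) v = sinh a"
  shows "unit_tangent x (hyp_normal v x a)"
    and "mink (coords (hgeo x (hyp_normal v x a) t)) v = sinh (a + t)"
proof -
  have m: "mink v (coords x) = sinh a"
    using assms by (simp add: mink_commute)
  have "mink (hyp_normal v x a) (hyp_normal v x a) = (1 + sinh a ^ 2) / cosh a ^ 2"
    by (simp add: hyp_normal_def mink_linear assms m power2_eq_square field_simps)
  thus u: "unit_tangent x (hyp_normal v x a)"
    by (simp add: unit_tangent_def hyp_normal_def mink_linear assms cosh_square_eq add.commute)
       (simp add: add_nonneg_eq_0_iff)
  have "mink (hyp_normal v x a) v = (1 + sinh a ^ 2) / cosh a"
    by (simp add: hyp_normal_def mink_linear assms m power2_eq_square field_simps)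
  also have "\<dots> = cosh a"
    using cosh_square_eq[of a] by (simp add: add.commute power2_eq_square field_simps)
  finally show "mink (coords (hgeo x (hyp_normal v x a) t)) v = sinh (a + t)"
    by (simp add: mink_hgeo[OF u] assms sinh_add)
qed

lemma mink_hyp_normal:
  "mink X v = cosh a * mink X (hyp_normal v x a) - sinh a * mink X (coords x)"
  by (simp add: hyp_normal_def mink_linear field_simps)

text \<open>The signed distance from a hyperplane is 1-Lipschitz, with equality only along
  perpendiculars of the hyperplane.\<close>

lemma signed_dist:
  assumes "mink v v = 1" "mink (coords x) v = sinh a" "mink (coords y) v = sinh b"
  shows "\<bar>b - a\<bar> \<le> dist x y"
    and "\<bar>b - a\<bar> = dist x y \<Longrightarrow> y = hgeo x (hyp_normal v x a) (b - a)"
proof -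
  define t where "t = dist x y"
  have t: "t \<ge> 0"
    by (simp add: t_def)
  define n where "n = hyp_normal v x a"
  have n: "unit_tangent x n"
    unfolding n_def by (rule hyp_normal(1)[OF assms(1,2)])
  obtain u where u: "unit_tangent x u" "y = hgeo x u t"
    unfolding t_def by (rule geodesic_between)
  have "mink u v = cosh a * mink u n"
    using mink_hyp_normal[of u v a x] by (simp add: n_def unit_tangentD[OF u(1)])
  hence b: "sinh b = cosh t * sinh a + sinh t * cosh a * mink u n"
    using assms(3) by (simp add: u(2) mink_hgeo[OF u(1)] assms(2))
  have le: "\<bar>mink u n\<bar> \<le> 1"
    by (rule unit_tangent_mink[OF u(1) n])
  have st: "sinh t * cosh a \<ge> 0"
    using t by simp
  have "sinh t * cosh a * mink u n \<le> sinh t * cosh a * 1"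
    by (rule mult_left_mono[OF _ st]) (use le in linarith)
  hence "sinh b \<le> sinh (a + t)"
    by (simp add: b sinh_add algebra_simps)
  moreover have "sinh t * cosh a * mink u n \<ge> sinh t * cosh a * - 1"
    by (rule mult_left_mono[OF _ st]) (use le in linarith)
  hence "sinh b \<ge> sinh (a - t)"
    by (simp add: b sinh_diff algebra_simps)
  ultimately show "\<bar>b - a\<bar> \<le> dist x y"
    by (simp add: t_def)
  assume "\<bar>b - a\<bar> = dist x y"
  hence "b = a + t \<or> b = a - t"
    by (auto simp: t_def)
  show "y = hgeo x (hyp_normal v x a) (b - a)"
  proof (cases "t = 0")
    case True
    thus ?thesis
      using \<open>b = a + t \<or> b = a - t\<close> by (auto simp: u(2))
  next
    case False
    hence nz: "sinh t * cosh a \<noteq> 0"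
      by simp
    from \<open>b = a + t \<or> b = a - t\<close> show ?thesis
    proof
      assume "b = a + t"
      hence "sinh t * cosh a * mink u n = sinh t * cosh a * 1"
        using b by (simp add: sinh_add)
      hence "mink u n = 1"
        using nz by (metis mult_left_cancel)
      hence "u = n"
        by (rule unit_tangent_mink(2)[OF u(1) n])
      thus ?thesis
        by (simp add: u(2) n_def \<open>b = a + t\<close>)
    next
      assume "b = a - t"
      hence "sinh t * cosh a * mink u n = sinh t * cosh a * - 1"
        using b[unfolded \<open>b = a - t\<close>] by (simp add: sinh_diff algebra_simps)
      hence "mink u n = - 1"
        using nz by (metis mult_left_cancel)
      hence "u = - n"
        by (rule unit_tangent_mink(3)[OF u(1) n])
      thus ?thesis
        by (simp add: u(2) n_def hgeo_minus \<open>b = a - t\<close>)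
    qed
  qed
qed

section \<open>Supporting hyperplanes and completeness\<close>

lemma interior_extend:
  assumes "x \<in> interior K" "unit_tangent x n"
  obtains t where "t > 0" "hgeo x n t \<in> K"
proof -
  obtain e where e: "e > 0" "ball x e \<subseteq> K"
    using assms(1) by (auto simp: mem_interior)
  have "hgeo x n (e / 2) \<in> ball x e"
    using e by (simp add: dist_hgeo_0[OF assms(2)])
  with e that[of "e / 2"] show ?thesis by auto
qed

lemma interior_halfspace_less:
  assumes "x \<in> interior K" "mink v v = 1" "K \<subseteq> halfspace v"
  shows "mink (coords x) v < 0"
proof (rule ccontr)
  assume "\<not> ?thesis"
  moreover have "x \<in> halfspace v"
    using assms interior_subset by blast
  ultimately have "mink (coords x) v = 0"
    by (simp add: halfspace_def)
  hence v: "unit_tangent x v"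
    using assms by (simp add: unit_tangent_def)
  obtain t where t: "t > 0" "hgeo x v t \<in> K"
    using interior_extend[OF assms(1) v] .
  hence "mink (coords (hgeo x v t)) v \<le> 0"
    using assms(3) by (auto simp: halfspace_def)
  thus False
    using t by (simp add: mink_hgeo[OF v] unit_tangentD[OF v])
qed

lemma supports_atI:
  assumes "x \<in> K" "unit_tangent x v" "K \<subseteq> halfspace v"
  shows "supports_at K x (hyperplane v)"
proof -
  have "x \<notin> interior K"
    using interior_halfspace_less[of x K v] unit_tangentD[OF assms(2)] assms(3) by auto
  hence "x \<in> frontier K"
    using assms(1) closure_subset[of K] by (auto simp: frontier_def)
  thus ?thesis
    using assms unit_tangentD[OF assms(2)] unfolding supports_at_def hyperplane_def by blast
qed

lemma supports_atE:
  assumes "supports_at K x H" "closed K"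
  obtains v where "x \<in> K" "unit_tangent x v" "K \<subseteq> halfspace v" "H = hyperplane v"
proof -
  from assms obtain v where "x \<in> K" "mink v v = 1" "x \<in> H" "H = hyperplane v" "K \<subseteq> halfspace v"
    using frontier_subset_closed[of K] by (auto simp: supports_at_def)
  thus ?thesis
    using that[of v] by (simp add: unit_tangent_def hyperplane_def)
qed

text \<open>The property that links completeness to the widths: every normal of \<open>K\<close>, followed
  inwards for the length \<open>D\<close>, ends in \<open>K\<close>.\<close>

definition opposite_points :: "'a::euclidean_space hyp set \<Rightarrow> real \<Rightarrow> bool"
  where "opposite_points K D \<longleftrightarrow>
    (\<forall>x\<in>K. \<forall>n. unit_tangent x n \<longrightarrow> K \<subseteq> halfspace n \<longrightarrow> hgeo x n (- D) \<in> K)"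

lemma opposite_pointsD:
  assumes "opposite_points K D" "x \<in> K" "unit_tangent x n" "K \<subseteq> halfspace n"
  shows "hgeo x n (- D) \<in> K"
  using assms unfolding opposite_points_def by blast

lemma constant_width_iff:
  assumes "closed K" "hconvex K" "D > 0" and diam: "\<And>x y. x \<in> K \<Longrightarrow> y \<in> K \<Longrightarrow> dist x y \<le> D"
  shows "constant_width K D \<longleftrightarrow> opposite_points K D"
proof
  assume cw: "constant_width K D"
  show "opposite_points K D"
    unfolding opposite_points_def
  proof (intro ballI allI impI)
    fix x n assume x: "x \<in> K" "unit_tangent x n" "K \<subseteq> halfspace n"
    have s: "supports_at K x (hyperplane n)"
      using supports_atI[OF x] .
    hence "x \<in> frontier K"
      by (simp add: supports_at_def)
    moreover have "outer_unit_normal K x n"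
      using x s by (simp add: outer_unit_normal_def)
    ultimately have "\<exists>y\<in>frontier K. y = hgeo x (- n) D"
      using cw unfolding constant_width_def by blast
    thus "hgeo x n (- D) \<in> K"
      using frontier_subset_closed[OF assms(1)] by (auto simp: hgeo_minus)
  qed
next
  assume op: "opposite_points K D"
  show "constant_width K D"
    unfolding constant_width_def
  proof (intro ballI allI impI)
    fix x v assume "x \<in> frontier K" and n: "outer_unit_normal K x v"
    hence x: "x \<in> K"
      using frontier_subset_closed[OF assms(1)] by blast
    have v: "unit_tangent x v" "K \<subseteq> halfspace v"
      using n by (auto simp: outer_unit_normal_def)
    define y where "y = hgeo x v (- D)"
    have y: "y \<in> K"
      unfolding y_def using opposite_pointsD[OF op x v] .
    have dy: "dist x y = D"
      using assms(3) by (simp add: y_def dist_hgeo_0[OF v(1)])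
    have "y \<notin> interior K"
    proof
      assume "y \<in> interior K"
      then obtain e where e: "e > 0" "ball y e \<subseteq> K"
        by (auto simp: mem_interior)
      have "hgeo x v (- D - e / 2) \<in> ball y e"
        using e by (simp add: y_def dist_hgeo[OF v(1)])
      hence "dist x (hgeo x v (- D - e / 2)) \<le> D"
        using e x by (intro diam) auto
      thus False
        using e assms(3) by (simp add: dist_hgeo_0[OF v(1)])
    qed
    hence "y \<in> frontier K"
      using y closure_subset[of K] by (auto simp: frontier_def)
    moreover have "hsegment x y \<subseteq> K"
      using assms(2) x y by (auto simp: hconvex_def)
    ultimately show "\<exists>y\<in>frontier K. hsegment x y \<subseteq> K \<and> dist x y = D \<and> y = hgeo x (- v) D"
      using dy by (intro bexI[of _ y]) (auto simp: y_def hgeo_minus)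
  qed
qed

lemma cosh_minus_1_le: "cosh t - 1 \<le> (sinh t)\<^sup>2" for t :: real
proof -
  have "cosh t * 1 \<le> cosh t * cosh t"
    by (rule mult_left_mono) (auto simp: cosh_real_ge_1)
  thus ?thesis
    using cosh_square_eq[of t] unfolding power2_eq_square by linarith
qed

text \<open>The nearest point of a convex set has the direction to the given point as a normal.\<close>

lemma nearest_point_normal:
  assumes "compact K" "hconvex K" "K \<noteq> {}" "y \<notin> K"
  obtains x n r where "x \<in> K" "unit_tangent x n" "K \<subseteq> halfspace n" "r > 0" "y = hgeo x n r"
proof -
  have "continuous_on K (\<lambda>x. dist y x)"
    by (intro continuous_intros)
  then obtain x where x: "x \<in> K" "\<And>z. z \<in> K \<Longrightarrow> dist y x \<le> dist y z"
    using continuous_attains_inf[OF assms(1,3)] by blast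
  define r where "r = dist x y"
  have r: "r > 0"
    using x assms(4) by (auto simp: r_def)
  obtain n where n: "unit_tangent x n" "y = hgeo x n r"
    unfolding r_def by (rule geodesic_between)
  have "mink (coords q) n \<le> 0" if q: "q \<in> K" for q
  proof (rule ccontr)
    assume pos: "\<not> ?thesis"
    define t where "t = dist x q"
    obtain u where u: "unit_tangent x u" "q = hgeo x u t"
      unfolding t_def by (rule geodesic_between)
    have "sinh t * mink u n > 0"
      using pos by (simp add: u(2) mink_hgeo[OF u(1)] unit_tangentD[OF n(1)])
    moreover have "t \<ge> 0"
      by (simp add: t_def)
    ultimately have t: "t > 0" and un: "mink u n > 0"
      by (auto simp: zero_less_mult_iff)
    \<comment> \<open>The angle at \<open>x\<close> between \<open>y\<close> and \<open>q\<close> is acute, so a short step towards \<open>q\<close> comes closer to \<open>y\<close>.\<close>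
    define k where "k = sinh r * mink u n / cosh r"
    have k: "k > 0"
      using r un by (simp add: k_def)
    define s where "s = min t (arsinh (k / 2))"
    have s: "s > 0" "s \<le> t"
      using t k by (auto simp: s_def)
    have "sinh s \<le> sinh (arsinh (k / 2))"
      by (subst sinh_real_le_iff) (simp add: s_def)
    hence sk: "sinh s < k"
      using k by simp
    have "hgeo x u s \<in> hsegment x q"
      using hgeo_mem_hsegment[OF u(1), of s t] s by (simp add: u(2))
    hence "hgeo x u s \<in> K"
      using assms(2) x(1) q by (auto simp: hconvex_def)
    hence "dist y x \<le> dist y (hgeo x u s)"
      by (rule x)
    hence "cosh r \<le> cosh (dist (hgeo x u s) y)"
      using r by (subst cosh_real_nonneg_le_iff) (auto simp: r_def dist_commute)
    also have "\<dots> = cosh s * cosh r - sinh s * sinh r * mink u n"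
      by (simp add: cosh_dist n(2) mink_hgeo[OF u(1)] coords_hgeo[OF n(1)] mink_linear
          unit_tangentD[OF u(1)] unit_tangentD[OF n(1)])
    finally have "sinh s * sinh r * mink u n \<le> (cosh s - 1) * cosh r"
      by (simp add: algebra_simps)
    also have "\<dots> \<le> (sinh s)\<^sup>2 * cosh r"
      by (intro mult_right_mono cosh_minus_1_le) simp
    finally have "sinh s * (sinh r * mink u n) \<le> sinh s * (sinh s * cosh r)"
      by (simp add: power2_eq_square algebra_simps)
    hence "sinh r * mink u n \<le> sinh s * cosh r"
      using s by simp
    hence "k \<le> sinh s"
      by (simp add: k_def divide_le_eq)
    thus False
      using sk by simp
  qed
  hence "K \<subseteq> halfspace n"
    by (auto simp: halfspace_def)
  with x n r that show ?thesis by blast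
qed

text \<open>The formulation of completeness that is used in the sequel.\<close>

lemma diam_complete_iff:
  assumes "bounded K" "diameter K = D"
  shows "diam_complete K \<longleftrightarrow> (\<forall>y. (\<forall>q\<in>K. dist y q \<le> D) \<longrightarrow> y \<in> K)"
proof
  assume c: "diam_complete K"
  show "\<forall>y. (\<forall>q\<in>K. dist y q \<le> D) \<longrightarrow> y \<in> K"
  proof (intro allI impI, rule ccontr)
    fix y assume y: "\<forall>q\<in>K. dist y q \<le> D" "y \<notin> K"
    have D: "D \<ge> 0"
      using assms diameter_ge_0 by blast
    have "diameter (insert y K) \<le> D"
      unfolding diameter_def
      using y D diameter_bounded_bound[OF assms(1)] assms(2)
      by (auto intro!: cSup_least simp: dist_commute)
    moreover have "diameter K < diameter (insert y K)"
      using c y unfolding diam_complete_def by blast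
    ultimately show False
      using assms by simp
  qed
next
  assume c: "\<forall>y. (\<forall>q\<in>K. dist y q \<le> D) \<longrightarrow> y \<in> K"
  show "diam_complete K"
    unfolding diam_complete_def
  proof (intro allI impI)
    fix y assume "y \<notin> K"
    then obtain q where q: "q \<in> K" "dist y q > D"
      using c by force
    have "dist y q \<le> diameter (insert y K)"
      using q assms by (intro diameter_bounded_bound) auto
    thus "diameter K < diameter (insert y K)"
      using q assms by simp
  qed
qed

lemma opposite_points_imp_complete:
  assumes "compact K" "hconvex K" "K \<noteq> {}" "D > 0" "opposite_points K D"
    and y: "\<And>q. q \<in> K \<Longrightarrow> dist y q \<le> D"
  shows "y \<in> K"
proof (rule ccontr)
  assume "y \<notin> K"
  then obtain x n r where x: "x \<in> K" "unit_tangent x n" "K \<subseteq> halfspace n" "r > 0" "y = hgeo x n r"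
    using nearest_point_normal[OF assms(1-3)] by blast
  have "dist y (hgeo x n (- D)) \<le> D"
    using opposite_pointsD[OF assms(5) x(1-3)] by (rule y)
  thus False
    using x assms(4) by (simp add: dist_hgeo[OF x(2)])
qed

text \<open>If the point opposite to \<open>x\<close> along the normal \<open>n\<close> were too far from some \<open>q \<in> K\<close>, there
  would be a direction \<open>U\<close> that leaves \<open>K\<close> and makes an acute angle with the direction of
  every diameter of \<open>K\<close> that ends at \<open>x\<close>.\<close>

lemma escape_direction:
  assumes diam: "\<And>x y. x \<in> K \<Longrightarrow> y \<in> K \<Longrightarrow> dist x y \<le> D" and D: "D > 0"
    and p: "p \<in> interior K"
    and x: "x \<in> K" "unit_tangent x n" "K \<subseteq> halfspace n"
    and q: "q \<in> K" "dist (hgeo x n (- D)) q > D"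
  obtains U where "unit_tangent x U" "mink U n > 0"
    "\<And>w. unit_tangent x w \<Longrightarrow> hgeo x w D \<in> K \<Longrightarrow> mink U w > 0"
proof -
  note n = unit_tangentD[OF x(2)]
  have S: "sinh D > 0"
    using D by simp
  define m where "m = - mink (coords x) (coords q)"
  define M where "M = - mink (coords x) (coords p)"
  define a where "a = cosh D * (m - 1) / sinh D"
  have m: "m \<ge> 1"
    using mink_coords_le[of x q] by (simp add: m_def)
  hence a: "a \<ge> 0"
    using S by (simp add: a_def)
  have pK: "p \<in> K"
    using p interior_subset by blast
  have pn: "mink (coords p) n < 0"
    by (rule interior_halfspace_less[OF p n(3) x(3)])
  have M: "M > 1"
  proof -
    have "x \<noteq> p"
      using pn n(1) by auto
    hence "dist x p > 0" by simp
    hence "cosh 0 < cosh (dist x p)"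
      by (subst cosh_real_nonneg_less_iff) auto
    thus ?thesis
      by (simp add: M_def cosh_dist)
  qed
  have "\<not> - mink (coords (hgeo x n (- D))) (coords q) \<le> cosh D"
    using q(2) D by (subst dist_le_iff[symmetric]) auto
  hence "cosh D * m + sinh D * mink n (coords q) > cosh D"
    by (simp add: mink_hgeo[OF x(2)] m_def)
  hence qn: "mink (coords q) n + a > 0"
    using S by (simp add: a_def mink_commute[of n] field_simps)
  \<comment> \<open>A small multiple of the direction to the interior point makes all angles strictly acute.\<close>
  define e where "e = (mink (coords q) n + a) / (- 2 * mink (coords p) n)"
  have e: "e > 0"
    using qn pn unfolding e_def by (intro divide_pos_pos) auto
  \<comment> \<open>The tangential parts of \<open>q\<close> and \<open>p\<close> at \<open>x\<close>; the former has product at least \<open>a\<close> with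
    each direction of a diameter from \<open>x\<close>, and more than \<open>- a\<close> with \<open>n\<close>.\<close>
  define u where "u = coords q - m *\<^sub>R coords x + a *\<^sub>R n + e *\<^sub>R (coords p - M *\<^sub>R coords x)"
  have xu: "mink (coords x) u = 0"
    by (simp add: u_def mink_linear n m_def M_def)
  have "mink u n = mink (coords q) n + a + e * mink (coords p) n"
    by (simp add: u_def mink_linear n)
  also have "\<dots> = (mink (coords q) n + a) / 2"
    using pn by (simp add: e_def field_simps)
  finally have un: "mink u n > 0"
    using qn by simp
  hence u0: "u \<noteq> 0"
    by (auto simp: mink_def)
  have uw: "mink u w > 0" if w: "unit_tangent x w" "hgeo x w D \<in> K" for w
  proof -
    note w' = unit_tangentD[OF w(1)]
    have "- mink (coords (hgeo x w D)) (coords q) \<le> cosh D"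
      using diam[OF w(2) q(1)] D by (simp add: dist_le_iff)
    hence 1: "mink (coords q) w \<ge> a"
      using S by (simp add: mink_hgeo[OF w(1)] m_def a_def mink_commute[of w] field_simps)
    have "- mink (coords (hgeo x w D)) (coords p) \<le> cosh D"
      using diam[OF w(2) pK] D by (simp add: dist_le_iff)
    hence "mink (coords p) w \<ge> cosh D * (M - 1) / sinh D"
      using S by (simp add: mink_hgeo[OF w(1)] M_def mink_commute[of w] field_simps)
    moreover have "cosh D * (M - 1) / sinh D > 0"
      using M S by (intro divide_pos_pos mult_pos_pos) auto
    ultimately have 2: "mink (coords p) w > 0"
      by linarith
    have "a * mink n w \<ge> a * - 1"
      using unit_tangent_mink(1)[OF x(2) w(1)] a by (intro mult_left_mono) auto
    moreover have "mink u w = mink (coords q) w + a * mink n w + e * mink (coords p) w"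
      by (simp add: u_def mink_linear w')
    moreover have "e * mink (coords p) w > 0"
      using e 2 by simp
    ultimately show ?thesis
      using 1 by linarith
  qed
  note U = unit_tangent_normalize[OF xu u0]
  show ?thesis
  proof (rule that[OF U(2)])
    show "mink (u /\<^sub>R sqrt (mink u u)) n > 0"
      using un U(1) by (simp add: mink_linear)
    show "mink (u /\<^sub>R sqrt (mink u u)) w > 0" if "unit_tangent x w" "hgeo x w D \<in> K" for w
      using uw[OF that] U(1) by (simp add: mink_linear)
  qed
qed

text \<open>Completeness forbids such a direction: points slightly outside of \<open>K\<close> in this direction
  are at distance more than \<open>D\<close> from points of \<open>K\<close>, and these accumulate at the end of a diameter
  that makes a non-acute angle with it.\<close>

lemma complete_imp_opposite_points:
  assumes "compact K" and diam: "\<And>x y. x \<in> K \<Longrightarrow> y \<in> K \<Longrightarrow> dist x y \<le> D" and D: "D > 0"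
    and p: "p \<in> interior K"
    and complete: "\<And>y. (\<And>q. q \<in> K \<Longrightarrow> dist y q \<le> D) \<Longrightarrow> y \<in> K"
  shows "opposite_points K D"
  unfolding opposite_points_def
proof (intro ballI allI impI, rule ccontr)
  fix x n assume x: "x \<in> K" "unit_tangent x n" "K \<subseteq> halfspace n" and "hgeo x n (- D) \<notin> K"
  then obtain q where "q \<in> K" "dist (hgeo x n (- D)) q > D"
    using complete[of "hgeo x n (- D)"] by force
  then obtain U where U: "unit_tangent x U" "mink U n > 0"
    "\<And>w. unit_tangent x w \<Longrightarrow> hgeo x w D \<in> K \<Longrightarrow> mink U w > 0"
    using escape_direction[OF diam D p x, of q] by blast
  note U' = unit_tangentD[OF U(1)]
  define t :: "nat \<Rightarrow> real" where "t k = inverse (real (Suc k))" for k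
  have t: "t k > 0" for k
    by (simp add: t_def)
  have t0: "t \<longlonglongrightarrow> 0"
    unfolding t_def by (rule LIMSEQ_inverse_real_of_nat)
  have "\<exists>q\<in>K. dist (hgeo x U (t k)) q > D" for k
  proof (rule ccontr)
    assume "\<not> ?thesis"
    hence "hgeo x U (t k) \<in> K"
      by (intro complete) force
    hence "mink (coords (hgeo x U (t k))) n \<le> 0"
      using x(3) by (auto simp: halfspace_def)
    moreover have "sinh (t k) * mink U n > 0"
      using t[of k] U(2) by simp
    ultimately show False
      by (simp add: mink_hgeo[OF U(1)] unit_tangentD[OF x(2)])
  qed
  then obtain r where r: "\<And>k. r k \<in> K" "\<And>k. dist (hgeo x U (t k)) (r k) > D"
    by metis
  obtain l f where l: "l \<in> K" "strict_mono f" "(r \<circ> f) \<longlonglongrightarrow> l"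
    using seq_compactE[OF compact_imp_seq_compact[OF assms(1)]] r(1) by metis
  have lim: "(\<lambda>k. mink X (coords (r (f k)))) \<longlonglongrightarrow> mink X (coords l)" for X
    using continuous_on_tendsto_compose[OF continuous_mink_coords[of UNIV X] l(3)]
    by (simp add: mink_commute[of X] o_def)
  have tf: "(\<lambda>k. t (f k)) \<longlonglongrightarrow> 0"
    using LIMSEQ_subseq_LIMSEQ[OF t0 l(2)] by (simp add: o_def)
  have gt: "cosh D < cosh (t k) * - mink (coords x) (coords (r k)) - sinh (t k) * mink U (coords (r k))" for k
    using dist_le_iff[of D "hgeo x U (t k)" "r k"] r(2)[of k] D
    by (simp add: mink_hgeo[OF U(1)])
  have le: "- mink (coords x) (coords (r k)) \<le> cosh D" for k
    using diam[OF x(1) r(1)[of k]] D by (simp add: dist_le_iff)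
  have "(\<lambda>k. cosh (t (f k)) * - mink (coords x) (coords (r (f k))) - sinh (t (f k)) * mink U (coords (r (f k))))
    \<longlonglongrightarrow> cosh 0 * - mink (coords x) (coords l) - sinh 0 * mink U (coords l)"
    by (intro tendsto_intros lim tf)
  hence "cosh D \<le> cosh 0 * - mink (coords x) (coords l) - sinh 0 * mink U (coords l)"
    by (rule LIMSEQ_le_const) (use gt in \<open>auto intro: less_imp_le\<close>)
  hence "cosh D \<le> cosh (dist x l)"
    by (simp add: cosh_dist)
  hence "dist x l = D"
    using diam[OF x(1) l(1)] D by (subst (asm) cosh_real_nonneg_le_iff) auto
  then obtain w where w: "unit_tangent x w" "l = hgeo x w D"
    using geodesic_between[of x l] by metis
  have "mink U (coords l) = sinh D * mink U w"
    by (simp add: w(2) coords_hgeo[OF w(1)] mink_linear U')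
  moreover have "mink U w > 0"
    using U(3)[OF w(1)] l(1) w(2) by simp
  ultimately have pos: "mink U (coords l) > 0"
    using D by simp
  have "mink U (coords (r k)) \<le> sinh (t k) * cosh D" for k
  proof -
    have "cosh (t k) * - mink (coords x) (coords (r k)) \<le> cosh (t k) * cosh D"
      by (rule mult_left_mono[OF le]) simp
    hence "sinh (t k) * mink U (coords (r k)) \<le> (cosh (t k) - 1) * cosh D"
      using gt[of k] by (simp add: algebra_simps)
    also have "\<dots> \<le> (sinh (t k))\<^sup>2 * cosh D"
      by (intro mult_right_mono cosh_minus_1_le) simp
    finally have "sinh (t k) * mink U (coords (r k)) \<le> sinh (t k) * (sinh (t k) * cosh D)"
      by (simp add: power2_eq_square algebra_simps)
    thus ?thesis
      using t[of k] by simp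
  qed
  moreover have "(\<lambda>k. sinh (t (f k)) * cosh D) \<longlonglongrightarrow> sinh 0 * cosh D"
    by (intro tendsto_intros tf)
  ultimately have "mink U (coords l) \<le> sinh 0 * cosh D"
    by (intro LIMSEQ_le[OF lim[of U], of "\<lambda>k. sinh (t (f k)) * cosh D"]) auto
  thus False
    using pos by simp
qed

section \<open>Evaluation of the hyperspherical width\<close>

text \<open>The distance from the hyperplane with normal \<open>v\<close>, positive on the side of \<open>v\<close>.\<close>

definition hdist :: "'a::euclidean_space \<times> real \<Rightarrow> 'a hyp \<Rightarrow> real"
  where "hdist v x = arsinh (mink (coords x) v)"

lemma sinh_hdist: "mink (coords x) v = sinh (hdist v x)"
  by (simp add: hdist_def)

lemma hdist_minus: "hdist (- v) x = - hdist v x"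
  by (simp add: hdist_def mink_linear)

lemma hyperplane_minus: "hyperplane (- v) = hyperplane v"
  by (simp add: hyperplane_def mink_linear)

lemma mem_hyperplane_iff: "x \<in> hyperplane v \<longleftrightarrow> hdist v x = 0"
  by (simp add: hyperplane_def hdist_def)

lemma mem_halfspace_iff: "x \<in> halfspace v \<longleftrightarrow> hdist v x \<le> 0"
  using sinh_real_le_iff[of "hdist v x" 0] by (simp add: halfspace_def sinh_hdist del: sinh_real_le_iff)

lemma continuous_hdist: "continuous_on A (hdist v)"
  unfolding hdist_def[abs_def] 
  by (rule continuous_on_compose2[OF continuous_on_arsinh[of UNIV] continuous_mink_coords]) simp

lemma hdist_hgeo_normal:
  assumes "mink v v = 1"
  shows "hdist v (hgeo x (hyp_normal v x (hdist v x)) t) = hdist v x + t"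
  using hyp_normal(2)[OF assms sinh_hdist, of x t] by (simp add: hdist_def[of v "hgeo _ _ _"] arsinh_sinh_real)

lemma hyperplane_foot:
  assumes "mink v v = 1"
  shows "hgeo x (hyp_normal v x (hdist v x)) (- hdist v x) \<in> hyperplane v"
  by (simp add: mem_hyperplane_iff hdist_hgeo_normal[OF assms])

lemma hyperplane_nonempty: "mink v v = 1 \<Longrightarrow> hyperplane v \<noteq> {}"
  using hyperplane_foot by blast

lemma infdist_hyperplane:
  assumes "mink v v = 1"
  shows "infdist x (hyperplane v) = \<bar>hdist v x\<bar>"
proof (rule antisym)
  let ?n = "hyp_normal v x (hdist v x)"
  have "unit_tangent x ?n"
    by (rule hyp_normal(1)[OF assms sinh_hdist])
  thus "infdist x (hyperplane v) \<le> \<bar>hdist v x\<bar>"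
    using infdist_le[OF hyperplane_foot[OF assms], of x x] by (simp add: dist_hgeo_0)
  have "\<bar>hdist v x\<bar> \<le> dist x y" if "y \<in> hyperplane v" for y
    using signed_dist(1)[OF assms sinh_hdist sinh_hdist, of x y] that by (simp add: mem_hyperplane_iff dist_commute)
  thus "\<bar>hdist v x\<bar> \<le> infdist x (hyperplane v)"
    using hyperplane_nonempty[OF assms] by (auto simp: infdist_notempty intro!: cINF_greatest)
qed

text \<open>Frontiers of horoballs and of neighbourhoods of hyperplanes are level sets, because
  from each of their points a geodesic leads to larger values of the defining function.\<close>

lemma frontier_sublevel:
  fixes f :: "'a::euclidean_space hyp \<Rightarrow> real"
  assumes f: "continuous_on UNIV f"
    and esc: "\<And>x. f x = c \<Longrightarrow> \<exists>u. unit_tangent x u \<and> (\<forall>t>0. f (hgeo x u t) > c)"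
  shows "frontier {x. f x \<le> c} = {x. f x = c}" "interior {x. f x \<le> c} = {x. f x < c}"
proof -
  have "open {x. f x < c}"
    using f by (intro open_Collect_less continuous_intros)
  hence 1: "{x. f x < c} \<subseteq> interior {x. f x \<le> c}"
    by (intro interior_maximal) auto
  have 2: "f x < c" if x: "x \<in> interior {x. f x \<le> c}" for x
  proof (rule ccontr)
    assume "\<not> f x < c"
    moreover have "f x \<le> c"
      using x interior_subset by blast
    ultimately obtain u where u: "unit_tangent x u" "\<And>t. t > 0 \<Longrightarrow> f (hgeo x u t) > c"
      using esc[of x] by auto
    obtain t where "t > 0" "hgeo x u t \<in> {x. f x \<le> c}"
      using interior_extend[OF x u(1)] .
    thus False
      using u(2)[of t] by simp
  qed
  show i: "interior {x. f x \<le> c} = {x. f x < c}"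
    using 1 2 by blast
  have "closed {x. f x \<le> c}"
    using f by (intro closed_Collect_le continuous_intros)
  hence "frontier {x. f x \<le> c} = {x. f x \<le> c} - {x. f x < c}"
    unfolding frontier_def i by simp
  thus "frontier {x. f x \<le> c} = {x. f x = c}"
    by auto
qed

lemma frontier_hyperplane_nbhd:
  assumes v: "mink v v = 1" and "e \<ge> 0"
  shows "frontier (hyperplane_nbhd (hyperplane v) e) = {x. \<bar>hdist v x\<bar> = e}"
  unfolding hyperplane_nbhd_def infdist_hyperplane[OF v]
proof (rule frontier_sublevel)
  show "continuous_on UNIV (\<lambda>x. \<bar>hdist v x\<bar>)"
    by (intro continuous_intros continuous_hdist)
next
  fix x assume x: "\<bar>hdist v x\<bar> = e"
  let ?n = "hyp_normal v x (hdist v x)"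
  have n: "unit_tangent x ?n"
    by (rule hyp_normal(1)[OF v sinh_hdist])
  show "\<exists>u. unit_tangent x u \<and> (\<forall>t>0. \<bar>hdist v (hgeo x u t)\<bar> > e)"
  proof (cases "hdist v x \<ge> 0")
    case True
    thus ?thesis
      using n x by (intro exI[of _ ?n] conjI) (auto simp: hdist_hgeo_normal[OF v])
  next
    case False
    thus ?thesis
      using n x by (intro exI[of _ "- ?n"] conjI) (auto simp: hgeo_minus hdist_hgeo_normal[OF v])
  qed
qed

lemma supporting_hyperspherical_iff:
  assumes v: "mink v v = 1"
  shows "supporting_hyperspherical K v e e' \<longleftrightarrow> e \<ge> 0 \<and> e' \<ge> 0 \<and>
    (\<forall>x\<in>K. hdist v x \<in> {- e'..e}) \<and> (\<exists>x\<in>K. hdist v x = e) \<and> (\<exists>x\<in>K. hdist v x = - e')"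
  (is "?L \<longleftrightarrow> ?R")
proof (cases "e \<ge> 0 \<and> e' \<ge> 0")
  case True
  have "?L \<longleftrightarrow> (\<forall>x\<in>K. \<bar>hdist v x\<bar> \<le> e \<and> hdist v x \<ge> 0 \<or> \<bar>hdist v x\<bar> \<le> e' \<and> hdist v x \<le> 0) \<and>
      (\<exists>x\<in>K. \<bar>hdist v x\<bar> = e \<and> hdist v x \<ge> 0) \<and> (\<exists>x\<in>K. \<bar>hdist v x\<bar> = e' \<and> hdist v x \<le> 0)"
    using True unfolding supporting_hyperspherical_def
    by (simp add: frontier_hyperplane_nbhd[OF v])
      (auto simp: mem_halfspace_iff hdist_minus hyperplane_nbhd_def infdist_hyperplane[OF v])
  also have "\<dots> \<longleftrightarrow> ?R"
  proof -
    have "(\<bar>hdist v x\<bar> \<le> e \<and> hdist v x \<ge> 0 \<or> \<bar>hdist v x\<bar> \<le> e' \<and> hdist v x \<le> 0)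
        \<longleftrightarrow> hdist v x \<in> {- e'..e}" for x
      using True by auto
    moreover have "(\<bar>hdist v x\<bar> = e \<and> hdist v x \<ge> 0) \<longleftrightarrow> hdist v x = e"
      "(\<bar>hdist v x\<bar> = e' \<and> hdist v x \<le> 0) \<longleftrightarrow> hdist v x = - e'" for x
      using True by auto
    ultimately show ?thesis
      using True by simp
  qed
  finally show ?thesis .
qed (auto simp: supporting_hyperspherical_def)

lemma hyperplane_normal_unique:
  assumes "mink v v = 1" "mink v' v' = 1" "hyperplane v = hyperplane v'"
  shows "v' = v \<or> v' = - v"
proof -
  obtain x where x: "x \<in> hyperplane v" "x \<in> hyperplane v'"
    using hyperplane_nonempty[OF assms(1)] assms(3) by blast
  hence m: "mink (coords x) v = 0" "mink (coords x) v' = 0"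
    by (simp_all add: hyperplane_def)
  define c where "c = mink v v'"
  define W where "W = v' - c *\<^sub>R v"
  have xW: "mink (coords x) W = 0"
    by (simp add: W_def mink_linear m)
  have vW: "mink v W = 0" "mink W v = 0"
    by (simp_all add: W_def mink_linear c_def assms mink_commute[of v' v])
  have "W = 0"
  proof (rule ccontr)
    assume W: "W \<noteq> 0"
    define s where "s = inverse (sqrt (mink W W))"
    note u = unit_tangent_normalize[OF xW W, folded s_def]
    have s: "s > 0"
      using u(1) by (simp add: s_def)
    have "mink (coords (hgeo x (s *\<^sub>R W) 1)) v = 0"
      by (simp add: mink_hgeo[OF u(2)] m mink_linear vW)
    hence "hgeo x (s *\<^sub>R W) 1 \<in> hyperplane v'"
      using assms(3) by (auto simp: hyperplane_def)
    hence "mink W v' = 0"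
      using s by (simp add: hyperplane_def mink_hgeo[OF u(2)] m mink_linear)
    hence "mink W W = 0"
      using vW by (simp add: W_def mink_linear)
    thus False
      using u(1) by simp
  qed
  hence v': "v' = c *\<^sub>R v"
    by (simp add: W_def)
  hence "c\<^sup>2 = 1"
    using assms by (simp add: mink_linear power2_eq_square)
  thus ?thesis
    using v' by (auto simp: power2_eq_1_iff)
qed

lemma hyp_width_eq:
  assumes v: "mink v v = 1" and "e \<ge> 0" "e' \<ge> 0"
    and K: "\<And>x. x \<in> K \<Longrightarrow> - e' \<le> hdist v x \<and> hdist v x \<le> e"
    and x: "x \<in> K" "hdist v x = e" and y: "y \<in> K" "hdist v y = - e'"
  shows "hyp_width K (hyperplane v) = e + e'"
  unfolding hyp_width_def
proof (rule the_equality)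
  have "supporting_hyperspherical K v e e'"
    unfolding supporting_hyperspherical_iff[OF v] using assms by auto
  thus "\<exists>va ea e'a. mink va va = 1 \<and> hyperplane v = hyperplane va \<and>
      supporting_hyperspherical K va ea e'a \<and> e + e' = ea + e'a"
    using v by blast
next
  fix w assume "\<exists>va ea e'a. mink va va = 1 \<and> hyperplane v = hyperplane va \<and>
      supporting_hyperspherical K va ea e'a \<and> w = ea + e'a"
  then obtain v1 e1 e1' where 1: "mink v1 v1 = 1" "hyperplane v = hyperplane v1"
    "supporting_hyperspherical K v1 e1 e1'" "w = e1 + e1'" by blast
  have h: "\<forall>z\<in>K. - e1' \<le> hdist v1 z \<and> hdist v1 z \<le> e1"
    "\<exists>z\<in>K. hdist v1 z = e1" "\<exists>z\<in>K. hdist v1 z = - e1'"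
    using 1(3) by (auto simp: supporting_hyperspherical_iff[OF 1(1)])
  from hyperplane_normal_unique[OF v 1(1,2)] show "w = e + e'"
  proof
    assume "v1 = v"
    with h K x y have "e1 = e" "e1' = e'"
      by force+
    thus ?thesis
      by (simp add: 1)
  next
    assume "v1 = - v"
    with h K x y have "e1 = e'" "e1' = e"
      by (force simp: hdist_minus)+
    thus ?thesis
      by (simp add: 1)
  qed
qed

lemma hdist_extremes:
  assumes "compact K" "K \<noteq> {}"
  obtains x y where "x \<in> K" "y \<in> K" "\<And>z. z \<in> K \<Longrightarrow> hdist v y \<le> hdist v z \<and> hdist v z \<le> hdist v x"
  using continuous_attains_sup[OF assms continuous_hdist[of K v]]
    continuous_attains_inf[OF assms continuous_hdist[of K v]] by blast

lemma hyp_width_eq_diff: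
  assumes v: "mink v v = 1" and "hyperplane v \<inter> K \<noteq> {}"
    and "x \<in> K" "y \<in> K" and K: "\<And>z. z \<in> K \<Longrightarrow> hdist v y \<le> hdist v z \<and> hdist v z \<le> hdist v x"
  shows "hyp_width K (hyperplane v) = hdist v x - hdist v y"
proof -
  obtain q where "q \<in> K" "hdist v q = 0"
    using assms(2) by (auto simp: mem_hyperplane_iff)
  with K[of q] have "hyp_width K (hyperplane v) = hdist v x + - hdist v y"
    using assms by (intro hyp_width_eq[where x = x and y = y]) auto
  thus ?thesis by simp
qed

section \<open>Evaluation of the width between horospheres\<close>

text \<open>The Busemann function of the ideal point \<open>i\<close>, whose level sets are the horospheres centred
  at \<open>i\<close>; it decreases towards \<open>i\<close>.\<close>

definition busemann :: "'a::euclidean_space \<Rightarrow> 'a hyp \<Rightarrow> real"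
  where "busemann i x = ln (- mink (coords x) (i, 1))"

text \<open>The unit tangent vector at \<open>x\<close> that points to the ideal point \<open>i\<close>.\<close>

definition ideal_direction :: "'a::euclidean_space \<Rightarrow> 'a hyp \<Rightarrow> 'a \<times> real"
  where "ideal_direction i x = (i, 1) /\<^sub>R (- mink (coords x) (i, 1)) - coords x"

lemma mink_ideal_neg:
  fixes i :: "'a::euclidean_space"
  assumes "norm i = 1"
  shows "mink (coords x) (i, 1) < 0"
proof -
  have "mink (coords x) (coords x) = - 1"
    by simp
  hence "norm (fst (coords x)) ^ 2 < snd (coords x) ^ 2"
    unfolding mink_def power2_norm_eq_inner by (simp add: power2_eq_square)
  hence "norm (fst (coords x)) < snd (coords x)"
    by (rule power2_less_imp_less) (simp add: less_imp_le snd_coords_pos)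
  moreover have "fst (coords x) \<bullet> i \<le> norm (fst (coords x)) * norm i"
    by (rule norm_cauchy_schwarz)
  ultimately show ?thesis
    using assms by (simp add: mink_def)
qed

lemma exp_busemann:
  assumes "norm i = 1"
  shows "mink (coords x) (i, 1) = - exp (busemann i x)"
  using mink_ideal_neg[OF assms, of x] by (simp add: busemann_def)

lemma continuous_busemann:
  assumes "norm i = 1"
  shows "continuous_on A (busemann i)"
  unfolding busemann_def using mink_ideal_neg[OF assms]
  by (intro continuous_intros continuous_mink_coords) (auto simp: less_imp_neq)

lemma mink_ideal_self:
  assumes "norm i = 1"
  shows "mink (i, 1) (i, 1) = 0"
  using assms by (simp add: mink_def flip: power2_norm_eq_inner)

lemma mink_ideal_direction:
  assumes "norm i = 1"
  shows "mink X (i, 1) = exp (busemann i x) * (mink X (coords x) + mink X (ideal_direction i x))"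
  by (simp add: ideal_direction_def mink_linear exp_busemann[OF assms] del: scaleR_Pair)

lemma ideal_direction:
  assumes i: "norm i = 1"
  shows "unit_tangent x (ideal_direction i x)"
    and "busemann i (hgeo x (ideal_direction i x) t) = busemann i x - t"
proof -
  let ?w = "ideal_direction i x"
  have xw: "mink (coords x) ?w = 0"
    using mink_ideal_neg[OF i, of x] by (simp add: ideal_direction_def mink_linear del: scaleR_Pair)
  have "mink ?w ?w = 1"
    using mink_ideal_neg[OF i, of x]
    by (simp add: ideal_direction_def mink_linear mink_ideal_self[OF i] mink_commute[of "(i, 1)" "coords x"]
      del: scaleR_Pair)
  with xw show w: "unit_tangent x ?w"
    by (simp add: unit_tangent_def)
  let ?y = "hgeo x ?w t"
  have "- exp (busemann i ?y) = exp (busemann i x) * (- cosh t + sinh t)"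
    unfolding exp_busemann[OF i, symmetric]
    by (subst mink_ideal_direction[OF i, of _ x]) (simp add: mink_hgeo[OF w] unit_tangentD[OF w])
  also have "\<dots> = - exp (busemann i x - t)"
    by (simp add: sinh_def cosh_def exp_diff exp_minus field_simps)
  finally show "busemann i ?y = busemann i x - t"
    by simp
qed

text \<open>Busemann functions are 1-Lipschitz, with equality only along lines to the ideal point.\<close>

lemma busemann_dist:
  assumes i: "norm i = 1"
  shows "\<bar>busemann i x - busemann i y\<bar> \<le> dist x y"
    and "\<bar>busemann i x - busemann i y\<bar> = dist x y \<Longrightarrow>
      y = hgeo x (ideal_direction i x) (busemann i x - busemann i y)"
proof -
  let ?w = "ideal_direction i x"
  define a where "a = busemann i x - busemann i y"
  define t where "t = dist x y"
  have t: "t \<ge> 0"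
    by (simp add: t_def)
  note w = ideal_direction(1)[OF i, of x]
  obtain u where u: "unit_tangent x u" "y = hgeo x u t"
    unfolding t_def by (rule geodesic_between)
  have "- exp (busemann i y) = exp (busemann i x) * (- cosh t + sinh t * mink u ?w)"
    unfolding exp_busemann[OF i, symmetric]
    by (subst mink_ideal_direction[OF i, of _ x])
       (simp add: u(2) mink_hgeo[OF u(1)] unit_tangentD[OF u(1)] unit_tangentD[OF w])
  hence ea: "exp (- a) = cosh t - sinh t * mink u ?w"
    by (simp add: a_def exp_diff field_simps)
  have le: "\<bar>mink u ?w\<bar> \<le> 1"
    by (rule unit_tangent_mink[OF u(1) w])
  have s: "sinh t \<ge> 0"
    using t by simp
  have "sinh t * mink u ?w \<le> sinh t * 1"
    by (rule mult_left_mono[OF _ s]) (use le in linarith)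
  hence "exp (- a) \<ge> exp (- t)"
    unfolding ea cosh_minus_sinh[of t, symmetric] by simp
  moreover have "sinh t * mink u ?w \<ge> sinh t * - 1"
    by (rule mult_left_mono[OF _ s]) (use le in linarith)
  hence "exp (- a) \<le> exp t"
    unfolding ea cosh_plus_sinh[of t, symmetric] by simp
  ultimately show "\<bar>busemann i x - busemann i y\<bar> \<le> dist x y"
    by (simp add: a_def t_def)
  assume "\<bar>busemann i x - busemann i y\<bar> = dist x y"
  hence at: "a = t \<or> a = - t"
    by (auto simp: t_def a_def)
  have "y = hgeo x ?w a"
  proof (cases "t = 0")
    case True
    thus ?thesis
      using at by (auto simp: u(2))
  next
    case False
    hence nz: "sinh t \<noteq> 0"
      by simp
    from at show ?thesis
    proof
      assume a: "a = t"
      have "sinh t * mink u ?w = sinh t * 1"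
        using ea a by (simp flip: cosh_minus_sinh)
      hence "mink u ?w = 1"
        using nz by (metis mult_left_cancel)
      thus ?thesis
        using unit_tangent_mink(2)[OF u(1) w] by (simp add: u(2) a)
    next
      assume a: "a = - t"
      have "sinh t * mink u ?w = sinh t * - 1"
        using ea a by (simp flip: cosh_plus_sinh)
      hence "mink u ?w = - 1"
        using nz by (metis mult_left_cancel)
      thus ?thesis
        using unit_tangent_mink(3)[OF u(1) w] by (simp add: u(2) a hgeo_minus)
    qed
  qed
  thus "y = hgeo x ?w (busemann i x - busemann i y)"
    by (simp add: a_def)
qed

lemma horoball_frontier_interior:
  assumes i: "norm i = 1" and c: "c > 0"
  shows "horoball i c = {x. busemann i x \<le> ln c}"
    and "frontier (horoball i c) = {x. busemann i x = ln c}"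
    and "interior (horoball i c) = {x. busemann i x < ln c}"
proof -
  have "- mink (coords x) (i, 1) \<le> c \<longleftrightarrow> busemann i x \<le> ln c" for x
    using mink_ideal_neg[OF i, of x] c by (simp add: busemann_def)
  thus h: "horoball i c = {x. busemann i x \<le> ln c}"
    by (simp add: horoball_def)
  have esc: "\<exists>u. unit_tangent x u \<and> (\<forall>t>0. busemann i (hgeo x u t) > ln c)"
    if "busemann i x = ln c" for x
    using that ideal_direction[OF i, of x]
    by (intro exI[of _ "- ideal_direction i x"]) (simp add: hgeo_minus)
  show "frontier (horoball i c) = {x. busemann i x = ln c}"
    and "interior (horoball i c) = {x. busemann i x < ln c}"
    unfolding h by (rule frontier_sublevel[OF continuous_busemann[OF i] esc]; assumption)+
qed

text \<open>In the Klein model, a geodesic tends to the point with the direction of the null vector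
  \<open>coords p + u\<close>.\<close>

lemma klein_limit:
  assumes u: "unit_tangent p u"
  shows "((\<lambda>t. fst (coords (hgeo p u t)) /\<^sub>R snd (coords (hgeo p u t)))
    \<longlongrightarrow> (fst (coords p) + fst u) /\<^sub>R (snd (coords p) + snd u)) at_top"
proof -
  have eq: "fst (coords (hgeo p u t)) /\<^sub>R snd (coords (hgeo p u t))
      = (fst (coords p) + tanh t *\<^sub>R fst u) /\<^sub>R (snd (coords p) + tanh t * snd u)" for t
  proof -
    have 1: "coords (hgeo p u t) = cosh t *\<^sub>R (coords p + tanh t *\<^sub>R u)"
      by (simp add: coords_hgeo[OF u] tanh_def scaleR_add_right)
    show ?thesis
      unfolding 1 by (simp add: scaleR_add_right[symmetric] inverse_mult_distrib mult.commute)
  qed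
  have "((\<lambda>t. (fst (coords p) + tanh t *\<^sub>R fst u) /\<^sub>R (snd (coords p) + tanh t * snd u))
    \<longlongrightarrow> (fst (coords p) + 1 *\<^sub>R fst u) /\<^sub>R (snd (coords p) + 1 * snd u)) at_top"
    using snd_unit_tangent_less[OF u] by (intro tendsto_intros tanh_real_at_top) auto
  thus ?thesis
    by (simp add: eq)
qed

text \<open>Every line ending at the ideal point can be parametrized by the Busemann function.\<close>

lemma ideal_line_param:
  assumes i: "norm i = 1" and l: "has_ideal_point l i"
  obtains g where "l = range g" "\<And>b. busemann i (g b) = b" "\<And>a b. dist (g a) (g b) = \<bar>a - b\<bar>"
proof -
  from l obtain p u where u: "unit_tangent p u" and l: "l = range (hgeo p u)" and
    lim: "((\<lambda>t. fst (coords (hgeo p u t)) /\<^sub>R snd (coords (hgeo p u t))) \<longlongrightarrow> i) at_top"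
    unfolding has_ideal_point_def by blast
  define s where "s = snd (coords p) + snd u"
  have s: "s > 0"
    using snd_unit_tangent_less[OF u] by (simp add: s_def)
  have "i = (fst (coords p) + fst u) /\<^sub>R s"
    unfolding s_def by (rule tendsto_unique[OF _ lim klein_limit[OF u]]) simp
  hence j: "(i, 1) = (coords p + u) /\<^sub>R s"
    using s by (simp add: s_def prod_eq_iff)
  have b: "busemann i (hgeo p u t) = - t - ln s" for t
  proof -
    have "- mink (coords (hgeo p u t)) (i, 1) = (cosh t - sinh t) / s"
      unfolding j using s
      by (simp add: mink_linear mink_hgeo[OF u] unit_tangentD[OF u] divide_inverse algebra_simps)
    also have "\<dots> = exp (- t) / s"
      by (simp add: cosh_minus_sinh)
    finally show ?thesis
      using s by (simp add: busemann_def ln_div)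
  qed
  define g where "g b = hgeo p u (- b - ln s)" for b
  have "range g = l"
  proof
    show "l \<subseteq> range g"
    proof
      fix x assume "x \<in> l"
      then obtain t where "x = hgeo p u t"
        using l by blast
      hence "x = g (- t - ln s)"
        by (simp add: g_def)
      thus "x \<in> range g" by blast
    qed
  qed (auto simp: l g_def)
  moreover have "busemann i (g a) = a" "dist (g a) (g c) = \<bar>a - c\<bar>" for a c
    by (simp_all add: g_def b dist_hgeo[OF u])
  ultimately show ?thesis
    using that by blast
qed

lemma ideal_line_exists:
  assumes i: "norm (i::'a::euclidean_space) = 1"
  obtains l where "hline l" "has_ideal_point l i"
proof -
  fix p :: "'a hyp"
  define u where "u = ideal_direction i p"
  have u: "unit_tangent p u"
    unfolding u_def by (rule ideal_direction(1)[OF i])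
  define s where "s = - mink (coords p) (i, 1)"
  have s: "s > 0"
    using mink_ideal_neg[OF i, of p] by (simp add: s_def)
  have pu: "fst (coords p) + fst u = i /\<^sub>R s" "snd (coords p) + snd u = 1 / s"
    by (simp_all add: u_def ideal_direction_def s_def divide_inverse)
  have "(fst (coords p) + fst u) /\<^sub>R (snd (coords p) + snd u) = i"
    using s by (simp add: pu)
  hence "has_ideal_point (range (hgeo p u)) i"
    unfolding has_ideal_point_def using u klein_limit[OF u] by metis
  moreover have "hline (range (hgeo p u))"
    unfolding hline_def using u by blast
  ultimately show ?thesis
    using that by blast
qed

lemma supporting_horosphere_iff:
  assumes i: "norm i = 1" and "closed K"
    and x: "x \<in> K" and y: "y \<in> K"
    and K: "\<And>z. z \<in> K \<Longrightarrow> busemann i y \<le> busemann i z \<and> busemann i z \<le> busemann i x"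
  shows "supporting_horosphere K i S \<longleftrightarrow>
    S = {z. busemann i z = busemann i x} \<or> S = {z. busemann i z = busemann i y}"
proof
  assume "supporting_horosphere K i S"
  then obtain c where c: "c > 0" "S = frontier (horoball i c)" "S \<inter> frontier K \<noteq> {}"
    "K \<subseteq> horoball i c \<or> K \<subseteq> - interior (horoball i c)"
    unfolding supporting_horosphere_def by blast
  note h = horoball_frontier_interior[OF i c(1)]
  obtain z where z: "z \<in> K" "busemann i z = ln c"
    using c(3) frontier_subset_closed[OF assms(2)] unfolding c(2) h(2) by auto
  have "(\<forall>z\<in>K. busemann i z \<le> ln c) \<or> (\<forall>z\<in>K. busemann i z \<ge> ln c)"
    using c(4) unfolding h(3) unfolding h(1) by force
  hence "ln c = busemann i x \<or> ln c = busemann i y"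
    using K[OF z(1)] x y z(2) by force
  thus "S = {z. busemann i z = busemann i x} \<or> S = {z. busemann i z = busemann i y}"
    unfolding c(2) h(2) by auto
next
  have fr: "z \<in> frontier K" if "z \<in> K" "z \<notin> interior K" for z
    using that closure_subset[of K] by (auto simp: frontier_def)
  have nx: "x \<notin> interior K"
  proof
    assume *: "x \<in> interior K"
    have u: "unit_tangent x (- ideal_direction i x)"
      using ideal_direction(1)[OF i, of x] by simp
    obtain t where "t > 0" "hgeo x (- ideal_direction i x) t \<in> K"
      using interior_extend[OF * u] .
    with K[of "hgeo x (- ideal_direction i x) t"] show False
      by (simp add: hgeo_minus ideal_direction(2)[OF i])
  qed
  have ny: "y \<notin> interior K"
  proof
    assume *: "y \<in> interior K"
    obtain t where "t > 0" "hgeo y (ideal_direction i y) t \<in> K"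
      using interior_extend[OF * ideal_direction(1)[OF i, of y]] by blast
    with K[of "hgeo y (ideal_direction i y) t"] show False
      by (simp add: ideal_direction(2)[OF i])
  qed
  have sup: "supporting_horosphere K i {z. busemann i z = busemann i q}"
    if q: "q \<in> K" "q \<notin> interior K"
      and side: "(\<forall>z\<in>K. busemann i z \<le> busemann i q) \<or> (\<forall>z\<in>K. busemann i z \<ge> busemann i q)" for q
  proof -
    have pos: "exp (busemann i q) > 0"
      by simp
    note h = horoball_frontier_interior[OF i pos]
    have "q \<in> {z. busemann i z = busemann i q} \<inter> frontier K"
      using fr[OF q] by simp
    moreover have "K \<subseteq> horoball i (exp (busemann i q)) \<or> K \<subseteq> - interior (horoball i (exp (busemann i q)))"
      unfolding h(3) unfolding h(1) using side by (auto simp: not_less)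
    ultimately show ?thesis
      unfolding supporting_horosphere_def using h(2)
      by (intro exI[of _ "exp (busemann i q)"]) auto
  qed
  assume "S = {z. busemann i z = busemann i x} \<or> S = {z. busemann i z = busemann i y}"
  thus "supporting_horosphere K i S"
    using sup[of x] sup[of y] x y nx ny K by blast
qed

lemma fillmore_width_eq:
  assumes i: "norm i = 1" and "closed K" and p: "p \<in> interior K"
    and x: "x \<in> K" and y: "y \<in> K"
    and K: "\<And>z. z \<in> K \<Longrightarrow> busemann i y \<le> busemann i z \<and> busemann i z \<le> busemann i x"
  shows "fillmore_width K i = busemann i x - busemann i y"
proof -
  define a where "a = busemann i x"
  define b where "b = busemann i y"
  have ab: "a > b"
  proof -
    obtain t where t: "t > 0" "hgeo p (ideal_direction i p) t \<in> K"
      using interior_extend[OF p ideal_direction(1)[OF i, of p]] by blast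
    moreover have "p \<in> K"
      using p interior_subset by blast
    ultimately show ?thesis
      using K[of p] K[OF t(2)] t by (simp add: ideal_direction(2)[OF i] a_def b_def)
  qed
  have supp: "supporting_horosphere K i S \<longleftrightarrow> S = {z. busemann i z = a} \<or> S = {z. busemann i z = b}" for S
    unfolding a_def b_def by (rule supporting_horosphere_iff[OF i assms(2) x y K])
  have cut: "\<exists>g. \<forall>c. l \<inter> {z. busemann i z = c} = {g c :: 'a hyp} \<and> (\<forall>d. dist (g c) (g d) = \<bar>c - d\<bar>)"
    if li: "has_ideal_point l i" for l
  proof -
    obtain g where g: "l = range g" "\<And>b. busemann i (g b) = b" "\<And>a b. dist (g a) (g b) = \<bar>a - b\<bar>"
      using ideal_line_param[OF i li] by blast
    thus ?thesis
      by (intro exI[of _ g]) auto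
  qed
  have "fillmore_width K i = a - b"
    unfolding fillmore_width_def
  proof (rule the_equality)
    have "\<exists>z. busemann i z = a" "\<exists>z. busemann i z = b"
      by (auto simp: a_def b_def)
    hence ne: "{z. busemann i z = a} \<noteq> {z. busemann i z = b}"
      using ab by auto
    show "\<exists>S S'. S \<noteq> S' \<and> supporting_horosphere K i S \<and> supporting_horosphere K i S' \<and>
      (\<forall>l. hline l \<and> has_ideal_point l i \<longrightarrow>
        (\<exists>x x'. l \<inter> S = {x} \<and> l \<inter> S' = {x'} \<and> dist x x' = a - b))"
    proof (rule exI[of _ "{z. busemann i z = a}"], rule exI[of _ "{z. busemann i z = b}"],
        intro conjI allI impI)
      fix l assume "hline l \<and> has_ideal_point l i"
      hence "has_ideal_point l i" ..
      from cut[OF this] obtain g where g: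
        "\<forall>c. l \<inter> {z. busemann i z = c} = {g c} \<and> (\<forall>d. dist (g c) (g d) = \<bar>c - d\<bar>)" ..
      show "\<exists>x x'. l \<inter> {z. busemann i z = a} = {x} \<and> l \<inter> {z. busemann i z = b} = {x'} \<and> dist x x' = a - b"
        using g ab by (intro exI[of _ "g a"] exI[of _ "g b"]) simp
    qed (use supp ne in auto)
  next
    fix w assume "\<exists>S S'. S \<noteq> S' \<and> supporting_horosphere K i S \<and> supporting_horosphere K i S' \<and>
      (\<forall>l. hline l \<and> has_ideal_point l i \<longrightarrow>
        (\<exists>x x'. l \<inter> S = {x} \<and> l \<inter> S' = {x'} \<and> dist x x' = w))"
    then obtain S S' where S: "S \<noteq> S'" "supporting_horosphere K i S" "supporting_horosphere K i S'"
      "\<And>l. hline l \<and> has_ideal_point l i \<Longrightarrow> \<exists>x x'. l \<inter> S = {x} \<and> l \<inter> S' = {x'} \<and> dist x x' = w"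
      by blast
    have "S = {z. busemann i z = a} \<and> S' = {z. busemann i z = b} \<or>
        S = {z. busemann i z = b} \<and> S' = {z. busemann i z = a}"
      using S(1-3) unfolding supp by blast
    moreover have "\<bar>a - b\<bar> = a - b" "\<bar>b - a\<bar> = a - b"
      using ab by auto
    ultimately obtain c d where
      cd: "S = {z. busemann i z = c}" "S' = {z. busemann i z = d}" "\<bar>c - d\<bar> = a - b"
      by metis
    obtain l :: "'a hyp set" where l: "hline l" "has_ideal_point l i"
      using ideal_line_exists[OF i] .
    from cut[OF l(2)] obtain g where g:
      "\<forall>c. l \<inter> {z. busemann i z = c} = {g c} \<and> (\<forall>d. dist (g c) (g d) = \<bar>c - d\<bar>)" ..
    obtain x x' where "l \<inter> S = {x}" "l \<inter> S' = {x'}" "dist x x' = w"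
      using S(4) l by blast
    thus "w = a - b"
      using g cd by auto
  qed
  thus ?thesis
    by (simp add: a_def b_def)
qed

section \<open>Evaluation of the width between supporting hyperplanes\<close>

text \<open>The velocity of the geodesic \<open>hgeo z v\<close> at time \<open>t\<close>.\<close>

definition velocity :: "'a::euclidean_space hyp \<Rightarrow> 'a \<times> real \<Rightarrow> real \<Rightarrow> 'a \<times> real"
  where "velocity z v t = sinh t *\<^sub>R coords z + cosh t *\<^sub>R v"

lemma velocity:
  assumes "unit_tangent z v"
  shows "unit_tangent (hgeo z v t) (velocity z v t)"
    and "hgeo (hgeo z v t) (velocity z v t) s = hgeo z v (t + s)"
proof -
  note v = unit_tangentD[OF assms]
  have "mink (velocity z v t) (velocity z v t) = 1"
    using cosh_square_eq[of t] by (simp add: velocity_def mink_linear v power2_eq_square)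
  moreover have "mink (coords (hgeo z v t)) (velocity z v t) = 0"
    by (simp add: velocity_def mink_linear v mink_hgeo[OF assms])
  ultimately show u: "unit_tangent (hgeo z v t) (velocity z v t)"
    by (simp add: unit_tangent_def)
  have "coords (hgeo (hgeo z v t) (velocity z v t) s) = coords (hgeo z v (t + s))"
    unfolding coords_hgeo[OF u] coords_hgeo[OF assms]
    by (simp add: velocity_def cosh_add sinh_add algebra_simps)
  thus "hgeo (hgeo z v t) (velocity z v t) s = hgeo z v (t + s)"
    by (simp add: coords_inject)
qed

lemma mink_velocity: "mink X (velocity z v t) = sinh t * mink X (coords z) + cosh t * mink X v"
  by (simp add: velocity_def mink_linear)

lemma mink_velocity_shift:
  "cosh s * mink X (velocity z v t) = mink X (coords z) * sinh (t - s) + cosh t * mink X (velocity z v s)"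
  by (simp add: mink_velocity sinh_diff algebra_simps)

lemma mink_hgeo_velocity:
  assumes "unit_tangent z v"
  shows "mink (coords (hgeo z v s)) (velocity z v t) = sinh (s - t)"
  by (simp add: mink_velocity mink_hgeo[OF assms] unit_tangentD[OF assms] sinh_diff)

lemma orthogonal_line_unique:
  assumes "unit_tangent z v" "z \<in> l" "orthogonal_to_hyperplane l (hyperplane v)"
  shows "l = range (hgeo z v)"
proof -
  note v = unit_tangentD[OF assms(1)]
  from assms(3) obtain p v' where p: "mink v' v' = 1" "hyperplane v = hyperplane v'"
    "p \<in> hyperplane v" "l = range (hgeo p v')"
    unfolding orthogonal_to_hyperplane_def by blast
  have pv': "unit_tangent p v'"
    using p by (simp add: unit_tangent_def) (simp add: hyperplane_def)
  obtain t where t: "z = hgeo p v' t"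
    using assms(2) p(4) by blast
  have "z \<in> hyperplane v'"
    using v p(2) by (auto simp: hyperplane_def)
  hence "t = 0"
    by (simp add: hyperplane_def t mink_hgeo[OF pv'] unit_tangentD[OF pv'])
  hence z: "z = p"
    by (simp add: t)
  have "range (hgeo p (- v)) = range (hgeo p v)"
    unfolding hgeo_minus by (metis range_composition[of "hgeo p v" uminus] surj_uminus)
  thus ?thesis
    using hyperplane_normal_unique[OF v(3) p(1,2)] p(4) z by auto
qed

lemma orthogonal_hyperplanes_of_line:
  assumes "unit_tangent z v" "orthogonal_to_hyperplane (range (hgeo z v)) H"
  obtains t where "H = hyperplane (velocity z v t)"
proof -
  from assms(2) obtain p v' where p: "mink v' v' = 1" "H = hyperplane v'"
    "p \<in> H" "range (hgeo z v) = range (hgeo p v')"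
    unfolding orthogonal_to_hyperplane_def by blast
  have pv': "unit_tangent p v'"
    using p by (simp add: unit_tangent_def hyperplane_def)
  have "hgeo p v' 0 \<in> range (hgeo z v)" "hgeo p v' 1 \<in> range (hgeo z v)"
    unfolding p(4) by blast+
  then obtain t s where t: "p = hgeo z v t" and s: "hgeo p v' 1 = hgeo z v s"
    by auto
  note N = velocity[OF assms(1), of t, folded t]
  define e where "e = s - t"
  have "\<bar>e\<bar> = 1"
    using dist_hgeo_0[OF pv', of 1] dist_hgeo[OF assms(1), of t s]
    by (simp only: s e_def flip: t)
  hence e: "e = 1 \<or> e = - 1"
    by linarith
  have "hgeo p v' 1 = hgeo p (velocity z v t) e"
    unfolding s N(2) by (simp add: e_def)
  hence "coords (hgeo p v' 1) = coords (hgeo p (velocity z v t) e)"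
    by simp
  hence "cosh 1 *\<^sub>R coords p + sinh 1 *\<^sub>R v' = cosh e *\<^sub>R coords p + sinh e *\<^sub>R velocity z v t"
    by (simp only: coords_hgeo[OF pv'] coords_hgeo[OF N(1)])
  hence "sinh 1 *\<^sub>R v' = sinh (1::real) *\<^sub>R velocity z v t \<or> sinh 1 *\<^sub>R v' = sinh (1::real) *\<^sub>R (- velocity z v t)"
    using e by auto
  moreover have "sinh (1::real) \<noteq> 0"
    by simp
  ultimately have "v' = velocity z v t \<or> v' = - velocity z v t"
    by (metis scaleR_cancel_left)
  hence "H = hyperplane (velocity z v t)"
    by (auto simp: p(2) hyperplane_minus)
  thus ?thesis ..
qed

text \<open>The hyperplanes orthogonal to the line \<open>hgeo z v\<close> are those with normal \<open>velocity z v t\<close>.  The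
  one with \<open>t = - w\<close> supports \<open>K\<close> on the other side.\<close>

lemma santalo_width_eq:
  assumes "closed K" and z: "z \<in> K" "unit_tangent z v" "K \<subseteq> halfspace v"
    and w: "w > 0" and K: "\<And>q. q \<in> K \<Longrightarrow> mink (coords q) (velocity z v (- w)) \<ge> 0"
    and y: "y \<in> K" "mink (coords y) (velocity z v (- w)) = 0"
  shows "santalo_width K z (hyperplane v) = w"
proof -
  note v = unit_tangentD[OF z(2)]
  let ?l = "range (hgeo z v)" and ?N = "velocity z v"
  have N1: "mink (?N t) (?N t) = 1" for t
    using velocity(1)[OF z(2)] by (simp add: unit_tangent_def)
  have lH: "?l \<inter> hyperplane (?N t) = {hgeo z v t}" for t
    by (auto simp: hyperplane_def mink_hgeo_velocity[OF z(2)])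
  have ortho: "orthogonal_to_hyperplane ?l (hyperplane (?N t))" for t
    unfolding orthogonal_to_hyperplane_def
  proof (intro exI conjI)
    show "hgeo z v t \<in> hyperplane (?N t)"
      using lH[of t] by blast
    show "?l = range (hgeo (hgeo z v t) (?N t))"
      unfolding velocity(2)[OF z(2)]
      using range_composition[of "hgeo z v" "\<lambda>s. t + s"] surj_plus[of t] by simp
  qed (rule N1 refl)+
  have N0: "?N 0 = v"
    by (simp add: velocity_def)
  have "(THE z'. \<exists>l H'. z \<in> l \<and> orthogonal_to_hyperplane l (hyperplane v) \<and>
      (\<exists>q. supports_at K q H') \<and> orthogonal_to_hyperplane l H' \<and> H' \<inter> hyperplane v = {} \<and>
      H' \<inter> l = {z'}) = hgeo z v (- w)"
  proof (rule the_equality)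
    have "supports_at K y (hyperplane (- ?N (- w)))"
      using y K N1 by (intro supports_atI) (auto simp: unit_tangent_def halfspace_def mink_linear)
    hence s: "supports_at K y (hyperplane (?N (- w)))"
      by (simp add: hyperplane_minus)
    have "x \<notin> hyperplane v" if "x \<in> hyperplane (?N (- w))" for x
      using that w mink_coords_le[of x z] by (auto simp: hyperplane_def mink_velocity)
    hence d: "hyperplane (?N (- w)) \<inter> hyperplane v = {}"
      by blast
    have "z \<in> ?l"
      by (metis hgeo_0 rangeI)
    thus "\<exists>l H'. z \<in> l \<and> orthogonal_to_hyperplane l (hyperplane v) \<and>
      (\<exists>q. supports_at K q H') \<and> orthogonal_to_hyperplane l H' \<and> H' \<inter> hyperplane v = {} \<and>
      H' \<inter> l = {hgeo z v (- w)}"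
      using s d ortho[of 0, unfolded N0] ortho[of "- w"] lH[of "- w"]
      by (intro exI[of _ ?l] exI[of _ "hyperplane (?N (- w))"]) (auto simp: Int_commute)
  next
    fix z' assume "\<exists>l H'. z \<in> l \<and> orthogonal_to_hyperplane l (hyperplane v) \<and>
      (\<exists>q. supports_at K q H') \<and> orthogonal_to_hyperplane l H' \<and> H' \<inter> hyperplane v = {} \<and>
      H' \<inter> l = {z'}"
    then obtain l H' q where *: "z \<in> l" "orthogonal_to_hyperplane l (hyperplane v)" "supports_at K q H'"
      "orthogonal_to_hyperplane l H'" "H' \<inter> hyperplane v = {}" "H' \<inter> l = {z'}"
      by blast
    have l: "l = ?l"
      using orthogonal_line_unique[OF z(2) *(1,2)] .
    obtain t where t: "H' = hyperplane (?N t)"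
      using orthogonal_hyperplanes_of_line[OF z(2) *(4)[unfolded l]] .
    obtain n where n: "q \<in> K" "unit_tangent q n" "K \<subseteq> halfspace n" "H' = hyperplane n"
      using supports_atE[OF *(3) assms(1)] .
    have nN: "n = ?N t \<or> n = - ?N t"
      using hyperplane_normal_unique[OF N1[of t], of n] unit_tangentD[OF n(2)] t n(4) by metis
    hence qN: "mink (coords q) (?N t) = 0"
      using unit_tangentD[OF n(2)] by (auto simp: mink_linear)
    from nN have "t = - w"
    proof
      \<comment> \<open>A hyperplane facing the same way as the given one is the given one, which is not disjoint.\<close>
      assume n': "n = ?N t"
      have "mink (coords z) n \<le> 0"
        using n(3) z(1) by (auto simp: halfspace_def)
      hence "t \<ge> 0"
        by (simp add: n' mink_velocity v)
      moreover have "mink (coords q) v \<le> 0"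
        using n(1) z(3) by (auto simp: halfspace_def)
      hence "cosh t * mink (coords q) v \<le> 0"
        by (simp add: mult_le_0_iff)
      hence "sinh t * mink (coords q) (coords z) \<ge> 0"
        using qN by (simp add: mink_velocity)
      hence "sinh t \<le> 0"
        using mink_coords_le[of q z] by (auto simp: zero_le_mult_iff)
      hence "t \<le> 0"
        by simp
      ultimately have "H' = hyperplane v"
        by (simp add: t N0)
      thus ?thesis
        using *(5) hyperplane_nonempty[OF v(3)] by simp
    next
      assume n': "n = - ?N t"
      have "mink (coords y) (?N t) \<ge> 0"
        using n(3) y(1) by (auto simp: halfspace_def n' mink_linear)
      hence "cosh (- w) * mink (coords y) (?N t) \<ge> 0"
        by simp
      hence "mink (coords y) (coords z) * sinh (t + w) \<ge> 0"
        unfolding mink_velocity_shift[of "- w"] y(2) by simp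
      hence "sinh (t + w) \<le> 0"
        using mink_coords_le[of y z] by (auto simp: zero_le_mult_iff)
      moreover have "cosh t * mink (coords q) (?N (- w)) \<ge> 0"
        using K[OF n(1)] by simp
      hence "mink (coords q) (coords z) * sinh (- w - t) \<ge> 0"
        unfolding mink_velocity_shift[of t] qN by simp
      hence "sinh (- w - t) \<le> 0"
        using mink_coords_le[of q z] by (auto simp: zero_le_mult_iff)
      ultimately show ?thesis
        by simp
    qed
    thus "z' = hgeo z v (- w)"
      using *(6) lH[of t] by (simp add: l t Int_commute)
  qed
  thus ?thesis
    unfolding santalo_width_def using w by (simp add: dist_hgeo_0[OF z(2)])
qed

text \<open>Existence of the second supporting hyperplane; it differs from the first one because \<open>K\<close> has an
  interior point.\<close>

lemma opposite_supporting_hyperplane: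
  assumes "compact K" and p: "p \<in> interior K" and z: "z \<in> K" "unit_tangent z v" "K \<subseteq> halfspace v"
  obtains w y where "w > 0" "\<And>q. q \<in> K \<Longrightarrow> mink (coords q) (velocity z v (- w)) \<ge> 0"
    "y \<in> K" "mink (coords y) (velocity z v (- w)) = 0"
proof -
  note v = unit_tangentD[OF z(2)]
  have neg: "mink (coords q) (coords z) < 0" for q
    using mink_coords_le[of q z] by linarith
  \<comment> \<open>The hyperbolic tangent of the coordinate of the foot of \<open>q\<close> on the line.\<close>
  define r where "r q = mink (coords q) v / - mink (coords q) (coords z)" for q
  have "continuous_on K r"
    unfolding r_def using neg
    by (intro continuous_intros continuous_mink_coords) (auto simp: less_imp_neq)
  then obtain y where y: "y \<in> K" "\<And>q. q \<in> K \<Longrightarrow> r y \<le> r q"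
    using continuous_attains_inf[OF assms(1), of r] z(1) by blast
  have "p \<in> K"
    using p interior_subset by blast
  hence "r y \<le> r p"
    by (rule y)
  also have "r p < 0"
    using interior_halfspace_less[OF p v(3) z(3)] neg[of p]
    unfolding r_def by (intro divide_neg_pos) auto
  finally have r0: "r y < 0" .
  have "\<bar>r y\<bar> < 1"
  proof -
    obtain u where u: "unit_tangent z u" "y = hgeo z u (dist z y)"
      by (rule geodesic_between)
    define t where "t = dist z y"
    have "\<bar>r y\<bar> = \<bar>tanh t\<bar> * \<bar>mink u v\<bar>"
      unfolding r_def by (subst (1 2) u(2))
        (simp add: mink_hgeo[OF u(1)] v unit_tangentD[OF u(1)] tanh_def abs_mult t_def)
    also have "\<dots> \<le> \<bar>tanh t\<bar> * 1"
      by (intro mult_left_mono unit_tangent_mink(1)[OF u(1) z(2)]) simp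
    also have "\<dots> < 1"
      using tanh_real_bounds[of t] by auto
    finally show ?thesis .
  qed
  \<comment> \<open>The solution \<open>w\<close> of \<open>tanh w = - r y\<close>.\<close>
  define s where "s = sqrt (1 - (r y)\<^sup>2)"
  have "(r y)\<^sup>2 < 1"
    using \<open>\<bar>r y\<bar> < 1\<close> by (simp add: abs_square_less_1)
  hence s: "s > 0" "s\<^sup>2 = 1 - (r y)\<^sup>2"
    by (simp_all add: s_def)
  define w where "w = arsinh (- r y / s)"
  have "(- r y / s)\<^sup>2 + 1 = (1 / s)\<^sup>2"
    using s by (simp add: power_divide field_simps)
  hence "cosh w = sqrt ((1 / s)\<^sup>2)"
    unfolding w_def cosh_arsinh_real by simp
  hence "cosh w = 1 / s"
    using s by simp
  hence sw: "sinh w = - r y * cosh w"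
    by (simp add: w_def)
  have "sinh w > 0"
    unfolding sw using r0 by (simp add: mult_neg_pos)
  hence w: "w > 0"
    by simp
  have eq: "mink (coords q) (velocity z v (- w)) = cosh w * - mink (coords q) (coords z) * (r q - r y)" for q
    using neg[of q] by (simp add: mink_velocity sw r_def field_simps)
  show ?thesis
  proof (rule that[OF w _ y(1)])
    show "mink (coords q) (velocity z v (- w)) \<ge> 0" if "q \<in> K" for q
      unfolding eq using neg[of q] y(2)[OF that] by (intro mult_nonneg_nonneg) auto
  qed (simp add: eq)
qed

section \<open>The widths of complete bodies\<close>

lemma hyp_normal_velocity:
  "hyp_normal (velocity z v (- t)) z t = v"
  by (simp add: hyp_normal_def velocity_def)

lemma opposite_points_iff_santalo:
  assumes "compact K" and p: "p \<in> interior K"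
    and diam: "\<And>x y. x \<in> K \<Longrightarrow> y \<in> K \<Longrightarrow> dist x y \<le> D" and D: "D > 0"
  shows "opposite_points K D \<longleftrightarrow>
    (\<forall>z\<in>frontier K. \<forall>H. supports_at K z H \<longrightarrow> santalo_width K z H = D)"
proof
  have cl: "closed K"
    using assms(1) by (rule compact_imp_closed)
  {
    assume op: "opposite_points K D"
    show "\<forall>z\<in>frontier K. \<forall>H. supports_at K z H \<longrightarrow> santalo_width K z H = D"
    proof (intro ballI allI impI)
      fix z H assume "supports_at K z H"
      then obtain v where z: "z \<in> K" "unit_tangent z v" "K \<subseteq> halfspace v" "H = hyperplane v"
        using cl by (rule supports_atE)
      let ?y = "hgeo z v (- D)"
      have y: "?y \<in> K"
        using opposite_pointsD[OF op z(1-3)] .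
      have "mink (coords q) (velocity z v (- D)) \<ge> 0" if q: "q \<in> K" for q
      proof -
        define m where "m = - mink (coords z) (coords q)"
        have m: "m \<le> cosh D"
          using diam[OF z(1) q] D by (simp add: dist_le_iff m_def)
        have "sinh D * mink v (coords q) \<ge> 1 - cosh D * m"
          using mink_coords_le[of ?y q] by (simp add: mink_hgeo[OF z(2)] m_def)
        hence "cosh D * (sinh D * mink v (coords q)) \<ge> cosh D * (1 - cosh D * m)"
          by (intro mult_left_mono) auto
        also have "cosh D * (1 - cosh D * m) = cosh D - (cosh D)\<^sup>2 * m"
          by (simp add: power2_eq_square algebra_simps)
        also have "\<dots> = (cosh D - m) - (sinh D)\<^sup>2 * m"
          unfolding cosh_square_eq by (simp add: algebra_simps)
        finally have "sinh D * (sinh D * m + cosh D * mink v (coords q)) \<ge> 0"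
          using m by (simp add: power2_eq_square algebra_simps)
        hence "sinh D * m + cosh D * mink v (coords q) \<ge> 0"
          using D by (meson mult_pos_neg not_le sinh_real_pos_iff)
        thus ?thesis
          by (simp add: mink_velocity m_def mink_commute[of "coords q"])
      qed
      thus "santalo_width K z H = D"
        unfolding z(4) using y D
        by (intro santalo_width_eq[OF cl z(1-3), of D ?y]) (auto simp: mink_hgeo_velocity[OF z(2)])
    qed
  }
  assume w: "\<forall>z\<in>frontier K. \<forall>H. supports_at K z H \<longrightarrow> santalo_width K z H = D"
  show "opposite_points K D"
    unfolding opposite_points_def
  proof (intro ballI allI impI)
    fix x n assume x: "x \<in> K" "unit_tangent x n" "K \<subseteq> halfspace n"
    obtain e y where e: "e > 0" "\<And>q. q \<in> K \<Longrightarrow> mink (coords q) (velocity x n (- e)) \<ge> 0"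
      "y \<in> K" "mink (coords y) (velocity x n (- e)) = 0"
      using opposite_supporting_hyperplane[OF assms(1) p x] by blast
    have "santalo_width K x (hyperplane n) = D"
      using w supports_atI[OF x] unfolding supports_at_def by blast
    hence "e = D"
      using santalo_width_eq[OF cl x e] by simp
    let ?v = "velocity x n (- D)"
    have v: "mink ?v ?v = 1"
      using velocity(1)[OF x(2)] by (simp add: unit_tangent_def)
    have "mink (coords x) ?v = sinh D"
      using mink_hgeo_velocity[OF x(2), of 0 "- D"] by simp
    moreover have "mink (coords y) ?v = sinh 0"
      using e(4) \<open>e = D\<close> by simp
    ultimately have "\<bar>0 - D\<bar> \<le> dist x y"
      "\<bar>0 - D\<bar> = dist x y \<Longrightarrow> y = hgeo x (hyp_normal ?v x D) (0 - D)"
      using signed_dist[OF v] by blast+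
    hence "y = hgeo x n (- D)"
      using diam[OF x(1) e(3)] D by (simp add: hyp_normal_velocity)
    thus "hgeo x n (- D) \<in> K"
      using e(3) by simp
  qed
qed

lemma ideal_point_of_direction:
  assumes "unit_tangent x n"
  obtains i where "norm i = 1" "ideal_direction i x = n"
proof -
  note n = unit_tangentD[OF assms]
  define s where "s = snd (coords x) + snd n"
  have s: "s > 0"
    using snd_unit_tangent_less[OF assms] by (simp add: s_def)
  define i where "i = (fst (coords x) + fst n) /\<^sub>R s"
  have i1: "(i, 1) = (coords x + n) /\<^sub>R s"
    using s by (simp add: i_def s_def prod_eq_iff)
  have "mink (i, 1) (i, 1) = 0"
    unfolding i1 by (simp add: mink_linear n)
  hence "(norm i)\<^sup>2 = 1"
    by (simp add: mink_def power2_norm_eq_inner)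
  hence "norm i = 1"
    by (metis norm_ge_zero power2_eq_1_iff neg_0_le_iff_le not_one_le_zero)
  moreover have "mink (coords x) (i, 1) = - inverse s"
    unfolding i1 by (simp add: mink_linear n)
  hence "ideal_direction i x = n"
    using s unfolding ideal_direction_def i1 by simp
  ultimately show ?thesis
    using that by blast
qed

lemma opposite_points_iff_fillmore:
  assumes "compact K" and p: "p \<in> interior K"
    and diam: "\<And>x y. x \<in> K \<Longrightarrow> y \<in> K \<Longrightarrow> dist x y \<le> D" and D: "D > 0"
  shows "opposite_points K D \<longleftrightarrow> (\<forall>i::'a::euclidean_space. norm i = 1 \<longrightarrow> fillmore_width K i = D)"
proof
  have cl: "closed K"
    using assms(1) by (rule compact_imp_closed)
  have K0: "K \<noteq> {}"
    using p interior_subset by blast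
  have ext: "\<exists>x\<in>K. \<exists>y\<in>K. \<forall>z\<in>K. busemann i y \<le> busemann i z \<and> busemann i z \<le> busemann i x"
    if "norm i = 1" for i :: 'a
    using continuous_attains_sup[OF assms(1) K0 continuous_busemann[OF that]]
      continuous_attains_inf[OF assms(1) K0 continuous_busemann[OF that]] by blast
  {
    assume op: "opposite_points K D"
    show "\<forall>i::'a. norm i = 1 \<longrightarrow> fillmore_width K i = D"
    proof (intro allI impI)
      fix i :: 'a assume i: "norm i = 1"
      obtain x y where x: "x \<in> K" and y: "y \<in> K" and
        xy: "\<And>z. z \<in> K \<Longrightarrow> busemann i y \<le> busemann i z \<and> busemann i z \<le> busemann i x"
        using ext[OF i] by blast
      let ?w = "ideal_direction i x"
      have w: "unit_tangent x (- ?w)"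
        using ideal_direction(1)[OF i, of x] by simp
      have "mink (coords q) (- ?w) \<le> 0" if q: "q \<in> K" for q
      proof -
        have "exp (busemann i x) * (mink (coords q) (coords x) + mink (coords q) ?w) \<ge> - exp (busemann i x)"
          using xy[OF q] by (simp add: exp_busemann[OF i] flip: mink_ideal_direction[OF i])
        hence "exp (busemann i x) * (mink (coords q) (coords x) + mink (coords q) ?w) \<ge> exp (busemann i x) * - 1"
          by simp
        hence "mink (coords q) (coords x) + mink (coords q) ?w \<ge> - 1"
          by (subst (asm) mult_le_cancel_left_pos) auto
        thus ?thesis
          using mink_coords_le[of q x] by (simp add: mink_linear)
      qed
      hence "K \<subseteq> halfspace (- ?w)"
        by (auto simp: halfspace_def)
      hence "hgeo x (- ?w) (- D) \<in> K"
        by (rule opposite_pointsD[OF op x w])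
      hence "busemann i y \<le> busemann i x - D"
        using xy by (force simp: hgeo_minus ideal_direction(2)[OF i])
      moreover have "\<bar>busemann i x - busemann i y\<bar> \<le> D"
        using busemann_dist(1)[OF i, of x y] diam[OF x y] by simp
      ultimately show "fillmore_width K i = D"
        using fillmore_width_eq[OF i cl p x y xy] by simp
    qed
  }
  assume w: "\<forall>i::'a. norm i = 1 \<longrightarrow> fillmore_width K i = D"
  show "opposite_points K D"
    unfolding opposite_points_def
  proof (intro ballI allI impI)
    fix x n assume x: "x \<in> K" "unit_tangent x n" "K \<subseteq> halfspace n"
    \<comment> \<open>The horosphere through \<open>x\<close> centred at the end of the outer normal is tangent to the supporting
      hyperplane and on its other side, so the Busemann function is minimal at \<open>x\<close>.\<close>
    obtain i where i: "norm i = 1" "ideal_direction i x = n"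
      using ideal_point_of_direction[OF x(2)] .
    have min: "busemann i x \<le> busemann i q" if q: "q \<in> K" for q
    proof -
      have "mink (coords q) n \<le> 0"
        using q x(3) by (auto simp: halfspace_def)
      hence "exp (busemann i x) * (mink (coords q) (coords x) + mink (coords q) n) \<le> exp (busemann i x) * - 1"
        using mink_coords_le[of q x] by (intro mult_left_mono) auto
      hence "mink (coords q) (i, 1) \<le> - exp (busemann i x)"
        unfolding mink_ideal_direction[OF i(1), of "coords q" x] i(2) by linarith
      hence "exp (busemann i x) \<le> exp (busemann i q)"
        unfolding exp_busemann[OF i(1)] by linarith
      thus ?thesis by simp
    qed
    obtain y where y: "y \<in> K" "\<And>z. z \<in> K \<Longrightarrow> busemann i z \<le> busemann i y"
      using ext[OF i(1)] by blast
    have "busemann i y - busemann i x = D"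
      using w i(1) fillmore_width_eq[OF i(1) cl p y(1) x(1)] min y(2) by simp
    moreover have "dist x y \<le> D"
      by (rule diam[OF x(1) y(1)])
    moreover from calculation have "y = hgeo x n (busemann i x - busemann i y)"
      using busemann_dist[OF i(1), of x y] by (simp add: i(2))
    moreover from calculation have "busemann i x - busemann i y = - D"
      by linarith
    ultimately have "y = hgeo x n (- D)"
      by metis
    thus "hgeo x n (- D) \<in> K"
      using y(1) by simp
  qed
qed

text \<open>As the hyperplane meets \<open>K\<close>, the maximal signed distance \<open>a\<close> is nonnegative; hence the side of
  the equidistant hypersurface that contains \<open>K\<close> is convex, and its normal is a normal of \<open>K\<close>.\<close>

lemma opposite_points_imp_hyp_width:
  assumes "compact K" and op: "opposite_points K D"
    and diam: "\<And>x y. x \<in> K \<Longrightarrow> y \<in> K \<Longrightarrow> dist x y \<le> D"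
    and v: "mink v v = 1" and H: "hyperplane v \<inter> K \<noteq> {}"
  shows "hyp_width K (hyperplane v) = D"
proof -
  have "K \<noteq> {}"
    using H by blast
  then obtain x y where x: "x \<in> K" and y: "y \<in> K" and
    xy: "\<And>z. z \<in> K \<Longrightarrow> hdist v y \<le> hdist v z \<and> hdist v z \<le> hdist v x"
    using hdist_extremes[OF assms(1), of v] by blast
  define a where "a = hdist v x"
  let ?n = "hyp_normal v x a"
  have n: "unit_tangent x ?n"
    unfolding a_def by (rule hyp_normal(1)[OF v sinh_hdist])
  obtain z where "z \<in> K" "hdist v z = 0"
    using H by (auto simp: mem_hyperplane_iff)
  hence a: "a \<ge> 0"
    using xy[of z] by (simp add: a_def)
  have "mink (coords q) ?n \<le> 0" if q: "q \<in> K" for q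
  proof -
    have "sinh a * mink (coords q) (coords x) \<le> sinh a * - 1"
      using a mink_coords_le[of q x] by (intro mult_left_mono) auto
    moreover have "mink (coords q) v \<le> sinh a"
      using xy[OF q] by (simp add: sinh_hdist a_def)
    ultimately have "cosh a * mink (coords q) ?n \<le> 0"
      using mink_hyp_normal[of "coords q" v a x] by simp
    thus ?thesis
      using cosh_real_pos[of a] by (meson mult_pos_pos not_le)
  qed
  hence "K \<subseteq> halfspace ?n"
    by (auto simp: halfspace_def)
  hence "hgeo x ?n (- D) \<in> K"
    by (rule opposite_pointsD[OF op x n])
  hence "hdist v y \<le> hdist v x - D"
    using xy[of "hgeo x ?n (- D)"] by (simp add: a_def hdist_hgeo_normal[OF v])
  moreover have "\<bar>hdist v y - hdist v x\<bar> \<le> D"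
    using signed_dist(1)[OF v sinh_hdist sinh_hdist, of y x] diam[OF x y] by simp
  ultimately show ?thesis
    using hyp_width_eq_diff[OF v H x y xy] by simp
qed

section \<open>Width with respect to the hyperplanes through one point\<close>

text \<open>The projection along \<open>coords p\<close>.  It maps hyperbolic space bijectively onto the Euclidean
  space \<open>'a\<close>, geodesics through \<open>p\<close> to lines through the origin, and the equidistant
  hypersurfaces of the hyperplanes through \<open>p\<close> to the Euclidean hyperplanes.\<close>

definition gans :: "'a::euclidean_space hyp \<Rightarrow> 'a hyp \<Rightarrow> 'a"
  where "gans p x = fst (coords x) - (snd (coords x) / snd (coords p)) *\<^sub>R fst (coords p)"

lemma gans_functional:
  fixes a :: "'a::euclidean_space"
  assumes "a \<noteq> 0"
  obtains v c where "c > 0" "unit_tangent p v" "\<And>x. mink (coords x) v = c * (a \<bullet> gans p x)"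
proof -
  define V where "V = (a, (fst (coords p) \<bullet> a) / snd (coords p))"
  have pV: "mink (coords p) V = 0"
    using snd_coords_pos[of p] by (simp add: V_def mink_def)
  have V0: "V \<noteq> 0"
    using assms by (simp add: V_def zero_prod_def)
  note V = unit_tangent_normalize[OF pV V0]
  have eq: "mink (coords x) V = a \<bullet> gans p x" for x
    by (simp add: V_def mink_def gans_def inner_diff_right inner_commute)
  show ?thesis
  proof (rule that[OF _ V(2)])
    show "inverse (sqrt (mink V V)) > 0"
      using V(1) by simp
    show "mink (coords x) (V /\<^sub>R sqrt (mink V V)) = inverse (sqrt (mink V V)) * (a \<bullet> gans p x)" for x
      by (simp add: mink_linear eq)
  qed
qed

lemma gans_origin: "gans p p = 0"
  using snd_coords_pos[of p] by (simp add: gans_def)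

text \<open>Points on a common ray from the origin lie on a geodesic ray from \<open>p\<close>, in the same order.\<close>

lemma gans_ray:
  assumes "gans p x = t *\<^sub>R gans p z" "t \<ge> 1"
  shows "z \<in> hsegment x p"
proof -
  let ?P = "coords p"
  have P: "snd ?P > 0"
    by (rule snd_coords_pos)
  define a where "a = inverse t"
  have a: "a > 0" "a \<le> 1"
    using assms(2) by (auto simp: a_def inverse_le_1_iff)
  define s where "s = (snd (coords z) - a * snd (coords x)) / snd ?P"
  have "gans p z = a *\<^sub>R gans p x"
    using assms by (simp add: a_def)
  hence "fst (coords z) = a *\<^sub>R fst (coords x) + s *\<^sub>R fst ?P"
    using P by (simp add: gans_def s_def algebra_simps diff_divide_distrib)
  moreover have "snd (coords z) = a * snd (coords x) + s * snd ?P"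
    using P by (simp add: s_def)
  ultimately have z: "coords z = a *\<^sub>R coords x + s *\<^sub>R ?P"
    by (simp add: prod_eq_iff)
  define m where "m = - mink (coords x) ?P"
  have m: "m \<ge> 1"
    using mink_coords_le[of x p] by (simp add: m_def)
  have "mink (coords z) (coords z) = - a\<^sup>2 - s\<^sup>2 - 2 * a * s * m"
    unfolding z by (simp add: mink_linear mink_commute[of ?P] m_def power2_eq_square algebra_simps)
  hence 1: "a\<^sup>2 + s * (s + 2 * a * m) = 1"
    by (simp add: power2_eq_square algebra_simps)
  have "mink (coords z) ?P = - a * m - s"
    unfolding z by (simp add: mink_linear m_def)
  hence 2: "s + a * m \<ge> 1"
    using mink_coords_le[of z p] by simp
  have am: "a * m > 0"
    using a m by simp
  have "s \<ge> 0"
  proof (rule ccontr)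
    assume "\<not> s \<ge> 0"
    moreover have "s + 2 * a * m > 0"
      using 2 am by simp
    ultimately have "s * (s + 2 * a * m) < 0"
      by (simp add: mult_neg_pos)
    moreover have "a\<^sup>2 \<le> 1"
      using a by (simp add: power_le_one)
    ultimately show False
      using 1 by linarith
  qed
  with a show ?thesis
    by (intro mem_hsegmentI[OF z]) auto
qed

lemma convex_insert_open_halfspace:
  fixes a w :: "'a::real_inner"
  assumes "a \<bullet> w = b"
  shows "convex (insert w {y. a \<bullet> y < b})"
proof (rule convexI)
  fix x y and u v :: real
  assume xy: "x \<in> insert w {y. a \<bullet> y < b}" "y \<in> insert w {y. a \<bullet> y < b}"
    and uv: "u \<ge> 0" "v \<ge> 0" "u + v = 1"
  have v: "v = 1 - u"
    using uv by simp
  consider "u = 0" | "v = 0" | "x = w" "y = w" | "u > 0" "v > 0" "x \<noteq> w \<or> y \<noteq> w"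
    using uv by linarith
  thus "u *\<^sub>R x + v *\<^sub>R y \<in> insert w {y. a \<bullet> y < b}"
  proof cases
    case 4
    have le: "a \<bullet> x \<le> b" "a \<bullet> y \<le> b"
      using xy assms by auto
    have "u * (a \<bullet> x) + v * (a \<bullet> y) < u * b + v * b"
    proof (cases "x = w")
      case True
      hence "a \<bullet> y < b"
        using 4 xy by auto
      thus ?thesis
        using 4 le by (intro add_le_less_mono mult_left_mono mult_strict_left_mono) auto
    next
      case False
      hence "a \<bullet> x < b"
        using xy by auto
      thus ?thesis
        using 4 le by (intro add_less_le_mono mult_left_mono mult_strict_left_mono) auto
    qed
    also have "u * b + v * b = b"
      by (simp add: v algebra_simps)
    finally show ?thesis
      by (simp add: inner_add_right)
  qed (use xy uv in \<open>auto simp flip: scaleR_add_left\<close>)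
qed

lemma continuous_gans: "continuous_on A (gans p)"
  unfolding gans_def
  by (intro continuous_intros continuous_on_subset[OF continuous_coords])
     (auto simp: snd_coords_pos less_imp_neq[OF snd_coords_pos, symmetric])

text \<open>If all hyperplanes through \<open>p\<close> yield the width \<open>D\<close>, then the two points of \<open>K\<close> that are
  extreme with respect to such a hyperplane are at distance \<open>D\<close> on a common perpendicular of it;
  hence either of them is unique.  So the convex hull of the image of \<open>K\<close> under \<^const>\<open>gans\<close> is
  touched by each supporting hyperplane at a single point, which is in the image; as the image is
  star-shaped about the origin, it is all of its convex hull.\<close>

lemma gans_image_convex:
  assumes "compact K" "hconvex K" and p: "p \<in> K"
    and diam: "\<And>x y. x \<in> K \<Longrightarrow> y \<in> K \<Longrightarrow> dist x y \<le> D"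
    and width: "\<And>v. unit_tangent p v \<Longrightarrow> hyp_width K (hyperplane v) = D"
    and z: "gans p z \<in> convex hull (gans p ` K)"
  shows "z \<in> K"
proof -
  define C where "C = convex hull (gans p ` K)"
  have C: "convex C" "compact C" "closed C"
    using compact_convex_hull[OF compact_continuous_image[OF continuous_gans assms(1)]]
    by (auto simp: C_def compact_imp_closed)
  have sub: "gans p q \<in> C" if "q \<in> K" for q
    using that by (simp add: C_def hull_inc)
  have star: "z \<in> K" if "x \<in> K" "gans p x = t *\<^sub>R gans p z" "t \<ge> 1" for x t
    using gans_ray[OF that(2,3)] assms(2) that(1) p unfolding hconvex_def by blast
  show ?thesis
  proof (cases "gans p z = 0")
    case True
    thus ?thesis
      using star[of p 1] p by (simp add: gans_origin)
  next
    case False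
    \<comment> \<open>The last point \<open>b\<close> of the convex hull on the ray through the image of \<open>z\<close>.\<close>
    define T where "T = {t. t *\<^sub>R gans p z \<in> C} \<inter> {1..}"
    have "closed T"
      unfolding T_def
      by (intro closed_Int closed_atLeast closed_vimage[OF C(3), unfolded vimage_def]
          continuous_intros)
    moreover have "bounded T"
    proof -
      obtain B where B: "\<And>y. y \<in> C \<Longrightarrow> norm y \<le> B"
        using compact_imp_bounded[OF C(2)] by (auto simp: bounded_iff)
      have "\<bar>t\<bar> \<le> B / norm (gans p z)" if "t \<in> T" for t
        using B[of "t *\<^sub>R gans p z"] that False by (simp add: T_def field_simps)
      thus ?thesis
        by (auto simp: bounded_iff)
    qed
    ultimately have "compact T"
      by (simp add: compact_eq_bounded_closed)
    moreover have "1 \<in> T"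
      using z by (simp add: T_def C_def)
    ultimately obtain t where t: "t \<in> T" "\<And>s. s \<in> T \<Longrightarrow> s \<le> t"
      using continuous_attains_sup[of T "\<lambda>t. t"] by auto
    define b where "b = t *\<^sub>R gans p z"
    have b: "b \<in> C" and t1: "t \<ge> 1"
      using t(1) by (auto simp: T_def b_def)
    have "b \<notin> rel_interior C"
    proof
      assume "b \<in> rel_interior C"
      hence "\<exists>e>1. (1 - e) *\<^sub>R gans p p + e *\<^sub>R b \<in> C"
        using convex_rel_interior_iff[OF C(1), of b] b sub[OF p] by blast
      then obtain e where e: "e > 1" "(e * t) *\<^sub>R gans p z \<in> C"
        by (auto simp: gans_origin b_def)
      have et: "e * t > 1 * t"
        using e t1 by (intro mult_strict_right_mono) auto
      hence "e * t \<ge> 1"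
        using t1 by linarith
      hence "e * t \<in> T"
        using e(2) by (simp add: T_def)
      thus False
        using t(2)[of "e * t"] et by linarith
    qed
    then obtain a' where a': "a' \<noteq> 0" "\<And>y. y \<in> C \<Longrightarrow> a' \<bullet> b \<le> a' \<bullet> y"
      using supporting_hyperplane_relative_frontier[OF C(1) subsetD[OF closure_subset b]]
        closure_subset[of C] by (metis subsetD)
    define a where "a = - a'"
    have a: "a \<noteq> 0" "\<And>y. y \<in> C \<Longrightarrow> a \<bullet> y \<le> a \<bullet> b"
      using a' by (simp_all add: a_def)
    obtain v c where c: "c > 0" and v: "unit_tangent p v"
      and m: "\<And>x. mink (coords x) v = c * (a \<bullet> gans p x)"
      using gans_functional[OF a(1), of p] by blast
    note v' = unit_tangentD[OF v]
    have "K \<noteq> {}"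
      using p by blast
    then obtain x y where x: "x \<in> K" and y: "y \<in> K" and
      xy: "\<And>z. z \<in> K \<Longrightarrow> hdist v y \<le> hdist v z \<and> hdist v z \<le> hdist v x"
      using hdist_extremes[OF assms(1), of v] by blast
    have "p \<in> hyperplane v"
      using v' by (simp add: hyperplane_def)
    hence "hyp_width K (hyperplane v) = hdist v x - hdist v y"
      using p by (intro hyp_width_eq_diff[OF v'(3) _ x y xy]) auto
    hence D: "D = hdist v x - hdist v y"
      using width[OF v] by simp
    have unique: "q = hgeo y (hyp_normal v y (hdist v y)) D" if q: "q \<in> K" "hdist v q = hdist v x" for q
    proof -
      note lip = signed_dist[OF v'(3) sinh_hdist sinh_hdist, of q y]
      have "\<bar>hdist v q - hdist v y\<bar> = dist y q"
        using lip(1) diam[OF y q(1)] D q(2) by linarith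
      from lip(2)[OF this] show ?thesis
        by (simp add: q(2) D)
    qed
    have order: "hdist v q \<le> hdist v q' \<longleftrightarrow> a \<bullet> gans p q \<le> a \<bullet> gans p q'" for q q'
      unfolding sinh_real_le_iff[of "hdist v q", symmetric] sinh_hdist[symmetric] m
      using c by simp
    have top: "a \<bullet> gans p x = a \<bullet> b"
    proof (rule antisym)
      show "a \<bullet> gans p x \<le> a \<bullet> b"
        using sub[OF x] by (rule a(2))
      have "gans p ` K \<subseteq> {y. a \<bullet> y \<le> a \<bullet> gans p x}"
        using xy by (auto simp flip: order)
      hence "C \<subseteq> {y. a \<bullet> y \<le> a \<bullet> gans p x}"
        unfolding C_def by (rule hull_minimal) (rule convex_halfspace_le)
      thus "a \<bullet> b \<le> a \<bullet> gans p x"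
        using b by blast
    qed
    have "gans p ` K \<subseteq> insert (gans p x) {y. a \<bullet> y < a \<bullet> b}"
    proof clarify
      fix q assume q: "q \<in> K" "gans p q \<noteq> gans p x"
      hence "hdist v q \<noteq> hdist v x"
        using unique[of q] unique[OF x] by auto
      hence "\<not> hdist v x \<le> hdist v q"
        using xy[OF q(1)] by simp
      thus "a \<bullet> gans p q < a \<bullet> b"
        unfolding order top by simp
    qed
    hence "C \<subseteq> insert (gans p x) {y. a \<bullet> y < a \<bullet> b}"
      unfolding C_def by (rule hull_minimal) (rule convex_insert_open_halfspace[OF top])
    hence "gans p x = t *\<^sub>R gans p z"
      using b by (auto simp: b_def)
    thus ?thesis
      by (rule star[OF x _ t1])
  qed
qed

lemma hyp_width_imp_complete:
  assumes "compact K" "hconvex K" and p: "p \<in> K"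
    and diam: "\<And>x y. x \<in> K \<Longrightarrow> y \<in> K \<Longrightarrow> dist x y \<le> D"
    and width: "\<And>v. unit_tangent p v \<Longrightarrow> hyp_width K (hyperplane v) = D"
    and z: "\<And>q. q \<in> K \<Longrightarrow> dist z q \<le> D"
  shows "z \<in> K"
proof (rule gans_image_convex[OF assms(1-3) diam width], assumption, assumption, assumption, rule ccontr)
  let ?C = "convex hull (gans p ` K)"
  assume "gans p z \<notin> ?C"
  moreover have "closed ?C"
    using compact_convex_hull[OF compact_continuous_image[OF continuous_gans assms(1)]]
    by (rule compact_imp_closed)
  ultimately obtain a' b where ab: "a' \<bullet> gans p z < b" "\<And>y. y \<in> ?C \<Longrightarrow> a' \<bullet> y > b"
    using separating_hyperplane_closed_point[of ?C "gans p z"] convex_convex_hull by blast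
  define a where "a = - a'"
  have a: "a \<bullet> gans p q < a \<bullet> gans p z" if "q \<in> K" for q
    using ab(1) ab(2)[of "gans p q"] that by (simp add: a_def hull_inc)
  hence "a \<noteq> 0"
    using p by force
  then obtain v c where c: "c > 0" and v: "unit_tangent p v"
    and m: "\<And>x. mink (coords x) v = c * (a \<bullet> gans p x)"
    using gans_functional[of a p] by blast
  note v' = unit_tangentD[OF v]
  have "K \<noteq> {}"
    using p by blast
  then obtain x y where x: "x \<in> K" and y: "y \<in> K" and
    xy: "\<And>z. z \<in> K \<Longrightarrow> hdist v y \<le> hdist v z \<and> hdist v z \<le> hdist v x"
    using hdist_extremes[OF assms(1), of v] by blast
  have "p \<in> hyperplane v"
    using v' by (simp add: hyperplane_def)
  hence "hyp_width K (hyperplane v) = hdist v x - hdist v y"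
    using p by (intro hyp_width_eq_diff[OF v'(3) _ x y xy]) auto
  moreover have "hdist v x < hdist v z"
    using c a[OF x] by (simp add: hdist_def m)
  moreover have "\<bar>hdist v y - hdist v z\<bar> \<le> dist z y"
    by (rule signed_dist(1)[OF v'(3) sinh_hdist sinh_hdist])
  ultimately show False
    using z[OF y] width[OF v] by simp
qed

section \<open>The equivalence\<close>

theorem theorem1p2:
  fixes K :: "'a::euclidean_space hyp set" and D :: real and p :: "'a hyp"
  assumes "DIM('a) \<ge> 2"
    and "convex_body K" and "diameter K = D" and "D > 0"
    and "p \<in> interior K"
  shows "(diam_complete K \<longleftrightarrow> K = (\<Inter>x\<in>K. cball x D)) \<and>
    (diam_complete K \<longleftrightarrow> constant_width K D) \<and>
    (diam_complete K \<longleftrightarrow> (\<forall>z\<in>frontier K. \<forall>H. supports_at K z H \<longrightarrow> santalo_width K z H = D)) \<and>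
    (diam_complete K \<longleftrightarrow> (\<forall>i::'a. norm i = 1 \<longrightarrow> fillmore_width K i = D)) \<and>
    (diam_complete K \<longleftrightarrow>
      (\<forall>H. is_hyperplane H \<and> p \<in> H \<longrightarrow> leichtweiss_width K p H = D)) \<and>
    (diam_complete K \<longleftrightarrow>
      (\<forall>H. is_hyperplane H \<and> H \<inter> K \<noteq> {} \<longrightarrow> extended_leichtweiss_width K H = D))"
proof -
  note D = \<open>D > 0\<close> and p = \<open>p \<in> interior K\<close>
  have K: "compact K" "hconvex K" "closed K" "bounded K"
    using assms(2) by (auto simp: convex_body_def compact_imp_closed compact_imp_bounded)
  have pK: "p \<in> K"
    using p interior_subset by blast
  have diam: "dist x y \<le> D" if "x \<in> K" "y \<in> K" for x y
    using diameter_bounded_bound[OF K(4) that] assms(3) by simp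
  have complete: "diam_complete K \<longleftrightarrow> (\<forall>y. (\<forall>q\<in>K. dist y q \<le> D) \<longrightarrow> y \<in> K)"
    by (rule diam_complete_iff[OF K(4) assms(3)])
  have balls: "diam_complete K \<longleftrightarrow> K = (\<Inter>x\<in>K. cball x D)"
  proof -
    have "K \<subseteq> (\<Inter>x\<in>K. cball x D)"
      using diam by auto
    moreover have "(\<Inter>x\<in>K. cball x D) \<subseteq> K \<longleftrightarrow> (\<forall>y. (\<forall>q\<in>K. dist y q \<le> D) \<longrightarrow> y \<in> K)"
      by (auto simp: dist_commute)
    ultimately show ?thesis
      unfolding complete by blast
  qed
  have opp: "diam_complete K \<longleftrightarrow> opposite_points K D"
  proof
    show "diam_complete K" if "opposite_points K D"
      unfolding complete using opposite_points_imp_complete[OF K(1,2) _ D that] pK by blast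
    show "opposite_points K D" if "diam_complete K"
      using that complete_imp_opposite_points[OF K(1) diam D p] unfolding complete by blast
  qed
  have all: "hyp_width K H = D" if "diam_complete K" "is_hyperplane H" "H \<inter> K \<noteq> {}" for H
    using that opposite_points_imp_hyp_width[OF K(1) _ diam] unfolding opp is_hyperplane_def by blast
  have one: "diam_complete K" if w: "\<And>H. is_hyperplane H \<Longrightarrow> p \<in> H \<Longrightarrow> hyp_width K H = D"
  proof -
    have "hyp_width K (hyperplane v) = D" if "unit_tangent p v" for v
      using unit_tangentD[OF that] unfolding is_hyperplane_def
      by (intro w[unfolded is_hyperplane_def]) (blast, simp add: hyperplane_def)
    thus ?thesis
      unfolding complete using hyp_width_imp_complete[OF K(1,2) pK diam] by blast
  qed
  have "diam_complete K \<longleftrightarrow> (\<forall>H. is_hyperplane H \<and> p \<in> H \<longrightarrow> leichtweiss_width K p H = D)"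
    unfolding leichtweiss_width_def using all one pK by blast
  moreover have "diam_complete K \<longleftrightarrow>
      (\<forall>H. is_hyperplane H \<and> H \<inter> K \<noteq> {} \<longrightarrow> extended_leichtweiss_width K H = D)"
    unfolding extended_leichtweiss_width_def using all one pK by blast
  moreover have "diam_complete K \<longleftrightarrow> constant_width K D"
    unfolding opp using constant_width_iff[OF K(3,2) D diam] by blast
  moreover have "diam_complete K \<longleftrightarrow>
      (\<forall>z\<in>frontier K. \<forall>H. supports_at K z H \<longrightarrow> santalo_width K z H = D)"
    unfolding opp by (rule opposite_points_iff_santalo[OF K(1) p diam D])
  moreover have "diam_complete K \<longleftrightarrow> (\<forall>i::'a. norm i = 1 \<longrightarrow> fillmore_width K i = D)"
    unfolding opp by (rule opposite_points_iff_fillmore[OF K(1) p diam D])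
  ultimately show ?thesis
    using balls by blast
qed

end
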